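(* Let $\Omega$ be a bounded open subset of $\mathbb R^3$ and let $\Gamma\subseteq\partial\Omega$. Let $\Omega'\subset\mathbb R^3$ be an open set such that $\overline\Omega\subset\Omega'$. Let $\mathbf v\in C^1(\Omega',\mathbb R^3)$ be such that $\mathrm{div}\,\mathbf v=0$ in $\Omega'$ and $\mathbf v=0$ on $\Gamma$. Then, for every sequence $(h_j)_{j\in\mathbb N}$ of strictly positive numbers with $\lim_{j\to\infty}h_j=0$, there exists a sequence $(\mathbf v_j)_{j\in\mathbb N}\subset C^1(\Omega',\mathbb R^3)$ such that $$\det(\mathbf I+h_j\nabla\mathbf v_j)=1\ \text{ in }\Omega,\qquad \mathbf v_j=0\ \text{ on }\Gamma,$$ $$\mathbf v_j\to\mathbf v\ \text{ in }W^{1,p}(\Omega,\mathbb R^3)\ \text{ for every }p\in[1,+\infty),\qquad \|h_j\nabla\mathbf v_j\|_{L^\infty(\Omega,\mathbb R^{3\times3})}\to0\ \text{ as }j\to+\infty.$$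
   Context: $\mathbf I$ denotes the $3\times3$ identity matrix. *)

theory Defs
  imports "HOL-Analysis.Analysis" "HOL-Probability.Essential_Supremum"
begin

text \<open>On differentiable maps the entry \<open>jacobian f (at x) $ i $ k\<close> is the partial derivative
  of the \<open>i\<close>-th component of \<open>f\<close> in direction \<open>k\<close>; it is used as the gradient matrix.\<close>

definition C1_on :: "(real^'n) set \<Rightarrow> (real^'n \<Rightarrow> real^'m) \<Rightarrow> bool" where
  "C1_on S f \<longleftrightarrow> (\<forall>x\<in>S. f differentiable (at x)) \<and> continuous_on S (\<lambda>x. jacobian f (at x))"

definition divergence :: "(real^'n \<Rightarrow> real^'n) \<Rightarrow> real^'n \<Rightarrow> real" where
  "divergence f x = (\<Sum>i\<in>UNIV. jacobian f (at x) $ i $ i)"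

definition partial_deriv :: "'n::finite \<Rightarrow> (real^'n \<Rightarrow> real) \<Rightarrow> real^'n \<Rightarrow> real" where
  "partial_deriv k \<phi> x = frechet_derivative \<phi> (at x) (axis k 1)"

primrec Ck :: "nat \<Rightarrow> (real^'n::finite \<Rightarrow> real) \<Rightarrow> bool" where
  "Ck 0 \<phi> \<longleftrightarrow> continuous_on UNIV \<phi>"
| "Ck (Suc m) \<phi> \<longleftrightarrow> (\<forall>x. \<phi> differentiable (at x)) \<and> (\<forall>k. Ck m (partial_deriv k \<phi>))"

definition test_function :: "(real^'n::finite) set \<Rightarrow> (real^'n \<Rightarrow> real) \<Rightarrow> bool" where
  "test_function S \<phi> \<longleftrightarrow> (\<forall>m. Ck m \<phi>) \<and>
     compact (closure {x. \<phi> x \<noteq> 0}) \<and> closure {x. \<phi> x \<noteq> 0} \<subseteq> S"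

definition has_weak_gradient ::
    "(real^'n::finite) set \<Rightarrow> (real^'n \<Rightarrow> real^'m) \<Rightarrow> (real^'n \<Rightarrow> real^'n^'m) \<Rightarrow> bool" where
  "has_weak_gradient S u G \<longleftrightarrow>
     (\<forall>K. compact K \<and> K \<subseteq> S \<longrightarrow> u absolutely_integrable_on K \<and> G absolutely_integrable_on K) \<and>
     (\<forall>\<phi> i k. test_function S \<phi> \<longrightarrow>
        (LINT x|lebesgue_on S. u x $ i * partial_deriv k \<phi> x) =
        - (LINT x|lebesgue_on S. G x $ i $ k * \<phi> x))"

definition Lp_space :: "(real^'n) set \<Rightarrow> real \<Rightarrow> (real^'n \<Rightarrow> 'b::euclidean_space) set" where
  "Lp_space S p = {f. f \<in> borel_measurable (lebesgue_on S) \<and>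
     integrable (lebesgue_on S) (\<lambda>x. norm (f x) powr p)}"

text \<open>\<open>Linf_norm\<close> takes values in \<^typ>\<open>ennreal\<close> rather than \<open>ereal\<close>, so that it is \<open>0\<close>,
  and not minus infinity, when \<open>S\<close> is a null set.\<close>

definition Linf_norm :: "(real^'n) set \<Rightarrow> (real^'n \<Rightarrow> 'b::euclidean_space) \<Rightarrow> ennreal" where
  "Linf_norm S f = esssup (lebesgue_on S) (\<lambda>x. ennreal (norm (f x)))"

text \<open>\<open>has_W1p_norm S p u N\<close> says that \<open>u\<close> belongs to the Sobolev space \<open>W\<^sup>1\<^sup>,\<^sup>p(S)\<close> and has norm
  \<open>N\<close> there. On an open set weak gradients are unique up to null sets, so \<open>N\<close> does not depend
  on the choice of \<open>G\<close>.\<close>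

definition has_W1p_norm ::
    "(real^'n::finite) set \<Rightarrow> real \<Rightarrow> (real^'n \<Rightarrow> real^'m) \<Rightarrow> real \<Rightarrow> bool" where
  "has_W1p_norm S p u N \<longleftrightarrow>
     (\<exists>G. u \<in> Lp_space S p \<and> G \<in> Lp_space S p \<and> has_weak_gradient S u G \<and>
        N = ((LINT x|lebesgue_on S. norm (u x) powr p) +
             (LINT x|lebesgue_on S. norm (G x) powr p)) powr (1 / p))"

definition W1p :: "(real^'n::finite) set \<Rightarrow> real \<Rightarrow> (real^'n \<Rightarrow> real^'m) set" where
  "W1p S p = {u. \<exists>N. has_W1p_norm S p u N}"

definition converges_in_W1p ::
    "(real^'n::finite) set \<Rightarrow> real \<Rightarrow> (nat \<Rightarrow> real^'n \<Rightarrow> real^'m) \<Rightarrow> (real^'n \<Rightarrow> real^'m) \<Rightarrow> bool"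
  where
  "converges_in_W1p S p us u \<longleftrightarrow> u \<in> W1p S p \<and> (\<forall>j. us j \<in> W1p S p) \<and>
     (\<exists>N. (\<forall>j. has_W1p_norm S p (\<lambda>x. us j x - u x) (N j)) \<and> N \<longlonglongrightarrow> 0)"

end

theory Submission
  imports Defs
begin

text \<open>
  After multiplication by a cutoff, \<open>v\<close> becomes a compactly supported field \<open>w\<close> that agrees with \<open>v\<close>
  near the closure of \<open>\<Omega>\<close>. Let \<open>\<phi>\<^sub>t\<close> be the flow of \<open>w\<close> and set \<open>v\<^sub>j = (\<phi>\<^sub>h - id) / h\<close> with \<open>h = h\<^sub>j\<close>,
  so that \<open>I + h \<nabla>v\<^sub>j\<close> is the gradient of \<open>\<phi>\<^sub>h\<close>. For small \<open>h\<close> the trajectories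
  issuing from \<open>\<Omega>\<close> stay where \<open>w = v\<close> is divergence free, hence the determinant is \<open>1\<close> by
  Liouville's formula. Uniform continuity of \<open>\<nabla>w\<close> gives uniform convergence of \<open>v\<^sub>j\<close> and
  \<open>\<nabla>v\<^sub>j\<close> on \<open>\<Omega>\<close>, and \<open>\<Gamma>\<close> consists of rest points. For the finitely many large \<open>h\<^sub>j\<close>,
  \<open>v\<^sub>j = 0\<close> will do. The flow up to time \<open>h\<close> is the time-one flow of \<open>h w\<close>, whose derivative is at
  most \<open>1/2\<close>, so existence and all estimates on \<open>[0, 1]\<close> come from a contraction.
\<close>

subsection \<open>The time-one flow of a field with small derivative\<close>

text \<open>On an interval of length 1 a Lipschitz constant below 1 makes the Picard operator a
  sup-norm contraction, so Banach's theorem applies directly. The time dependence of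
  \<open>f\<close> and the general Banach space allow one lemma to serve both trajectories and the
  operator-valued variational equation.\<close>

lemma integral_equation_solution:
  fixes f :: "real \<Rightarrow> 'b::banach \<Rightarrow> 'b"
  assumes cont: "\<And>g. continuous_on {0..1} g \<Longrightarrow> continuous_on {0..1} (\<lambda>t. f t (g t))"
    and K: "0 \<le> K" "K < 1"
    and lip: "\<And>t x y. t \<in> {0..1} \<Longrightarrow> norm (f t x - f t y) \<le> K * norm (x - y)"
  shows "\<exists>g. continuous_on {0..1} g \<and> (\<forall>t\<in>{0..1}. g t = a + integral {0..t} (\<lambda>s. f s (g s)))"
proof -
  define I where "I g t = a + integral {0..t} (\<lambda>s. f s (g s))" for g t
  have cg: "continuous_on {0..1} (\<lambda>s. f s (apply_bcontfun g s))" for g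
    by (rule cont) simp
  have int: "(\<lambda>s. f s (apply_bcontfun g s)) integrable_on {0..t}" if "t \<in> {0..1}" for g t
    using that by (intro integrable_continuous_real continuous_on_subset[OF cg]) auto
  \<comment> \<open>Bounded continuous functions on the whole line form a complete metric type.
    Clamping time to [0, 1] extends each Picard iterate constantly beyond the ends, so that it lies
    in this type.\<close>
  have "\<exists>h :: real \<Rightarrow>\<^sub>C 'b. \<forall>t. h t = I (apply_bcontfun g) (clamp 0 1 t)" for g
  proof -
    have "continuous_on (cbox 0 1) (I (apply_bcontfun g))"
      unfolding I_def interval_cbox[symmetric]
      by (intro continuous_intros indefinite_integral_continuous_1 integrable_continuous_real cg)
    then show ?thesis
      by (rule continuous_on_cbox_bcontfunE) auto
  qed
  then obtain T :: "(real \<Rightarrow>\<^sub>C 'b) \<Rightarrow> (real \<Rightarrow>\<^sub>C 'b)"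
    where T: "T g t = I (apply_bcontfun g) (clamp 0 1 t)" for g t
    by metis
  have "dist (T g) (T h) \<le> K * dist g h" for g h
  proof (rule dist_bound)
    fix t
    define r :: real where "r = clamp 0 1 t"
    have r: "r \<in> {0..1}"
      using clamp_in_interval[of 0 "1::real" t] by (auto simp: r_def)
    have "dist (T g t) (T h t) = norm (integral {0..r} (\<lambda>s. f s (g s) - f s (h s)))"
      using int[OF r] by (simp add: T I_def dist_norm integral_diff flip: r_def)
    also have "\<dots> \<le> (K * dist g h) * (r - 0)"
    proof (rule integral_bound)
      fix s assume "s \<in> {0..r}"
      then have "norm (f s (g s) - f s (h s)) \<le> K * dist (g s) (h s)"
        using lip[of s "g s" "h s"] r by (simp add: dist_norm)
      also have "\<dots> \<le> K * dist g h"
        using K by (intro mult_left_mono dist_bounded) auto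
      finally show "norm (f s (g s) - f s (h s)) \<le> K * dist g h" .
    qed (use r in \<open>auto intro!: continuous_intros continuous_on_subset[OF cg]\<close>)
    also have "\<dots> \<le> K * dist g h"
      using r K by (intro mult_left_le) auto
    finally show "dist (T g t) (T h t) \<le> K * dist g h" .
  qed
  with banach_fix_type[OF K, of T] obtain g where g: "T g = g"
    by blast
  have "apply_bcontfun g t = I (apply_bcontfun g) t" if "t \<in> {0..1}" for t
    using T[of g t] that by (simp add: g)
  then show ?thesis
    by (intro exI[of _ "apply_bcontfun g"]) (auto simp: I_def)
qed

text \<open>At a point where the norm of \<open>e\<close> is maximal, the integral contributes at
  most \<open>c\<close> plus half of that maximum. Absorbing the half yields the factor 2, with no
  exponential.\<close>

lemma contraction_gronwall:
  fixes e :: "real \<Rightarrow> 'b::banach"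
  assumes "continuous_on {0..1} e" and g: "continuous_on {0..1} g"
    and eq: "\<And>t. t \<in> {0..1} \<Longrightarrow> e t = e0 + integral {0..t} g"
    and bd: "\<And>s. s \<in> {0..1} \<Longrightarrow> norm (g s) \<le> c + norm (e s) / 2"
    and t: "t \<in> {0..1}"
  shows "norm (e t) \<le> 2 * (norm e0 + c)"
proof -
  have "continuous_on {0..1} (\<lambda>t. norm (e t))"
    by (intro continuous_intros assms)
  then obtain m where m: "m \<in> {0..1}" and max: "\<And>s. s \<in> {0..1} \<Longrightarrow> norm (e s) \<le> norm (e m)"
    using continuous_attains_sup[of "{0..1::real}" "\<lambda>t. norm (e t)"] by auto
  have "norm (integral {0..m} g) \<le> (c + norm (e m) / 2) * (m - 0)"
    using m bd max by (intro integral_bound continuous_on_subset[OF g]) (auto, smt (verit) bd field_sum_of_halves max atLeastAtMost_iff)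
  moreover have "0 \<le> c + norm (e m) / 2"
    using bd[OF m] norm_ge_zero order_trans by blast
  then have "(c + norm (e m) / 2) * (m - 0) \<le> c + norm (e m) / 2"
    using m by (intro mult_left_le) auto
  moreover have "norm (e m) \<le> norm e0 + norm (integral {0..m} g)"
    using eq[OF m] norm_triangle_ineq by metis
  ultimately show ?thesis
    using max[OF t] by argo
qed

lemma integrable_upto:
  fixes g :: "real \<Rightarrow> 'b::banach"
  assumes "continuous_on {0..1} g" "t \<in> {0..1}"
  shows "g integrable_on {0..t}"
  using assms by (intro integrable_continuous_real continuous_on_subset[OF assms(1)]) auto

lemma integral_upto_bound:
  fixes g :: "real \<Rightarrow> 'b::banach"
  assumes "continuous_on {0..1} g" "t \<in> {0..1}" "\<And>s. s \<in> {0..1} \<Longrightarrow> norm (g s) \<le> C"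
  shows "norm (integral {0..t} g) \<le> C"
proof -
  have "0 \<le> C"
    using assms(2,3) norm_ge_zero order_trans by blast
  moreover have "norm (integral {0..t} g) \<le> C * (t - 0)"
    using assms by (intro integral_bound continuous_on_subset[OF assms(1)]) auto
  ultimately show ?thesis
    using assms(2) mult_left_le[of t C] by auto
qed

section \<open>Flow of a field with small derivative, and its linearization\<close>

text \<open>The bound 1/2 makes all integral equations below contractive. \<kappa> is kept as a
  separate parameter because the first-order estimates are linear or quadratic in it; it later
  becomes \<open>h * B\<close>. Taking \<open>F'\<close> as a bounded linear function puts the
  variational equation into a Banach space.\<close>

locale small_field =
  fixes F :: "'a::euclidean_space \<Rightarrow> 'a" and F' :: "'a \<Rightarrow> 'a \<Rightarrow>\<^sub>L 'a" and \<kappa> :: real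
  assumes der: "\<And>x. (F has_derivative F' x) (at x)"
    and uc: "uniformly_continuous_on UNIV F'"
    and bd: "\<And>x. norm (F' x) \<le> \<kappa>"
    and \<kappa>: "\<kappa> \<le> 1/2"
begin

lemma \<kappa>_ge_0: "0 \<le> \<kappa>"
  using bd norm_ge_zero order_trans by blast

lemma lip: "norm (F y - F x) \<le> \<kappa> * norm (y - x)"
  by (rule differentiable_bound[of UNIV F "\<lambda>x. blinfun_apply (F' x)"])
    (auto intro: has_derivative_at_withinI der simp: bd norm_blinfun.rep_eq[symmetric])

lemma lip_half: "norm (F y - F x) \<le> norm (y - x) / 2"
proof -
  have "\<kappa> * norm (y - x) \<le> 1/2 * norm (y - x)"
    by (intro mult_right_mono \<kappa>) auto
  with lip[of y x] show ?thesis by simp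
qed

lemma F_continuous: "continuous_on S F"
  by (rule has_derivative_continuous_on[OF has_derivative_at_withinI[OF der]])

lemma F'_continuous: "continuous_on S F'"
  by (rule continuous_on_subset[OF uniformly_continuous_imp_continuous[OF uc]]) simp

lemma trajectory_ex:
  "\<exists>g :: real \<Rightarrow> 'a. continuous_on {0..1} g \<and> (\<forall>t\<in>{0..1}. g t = x + integral {0..t} (\<lambda>s. F (g s)))"
proof (rule integral_equation_solution[where f = "\<lambda>_. F" and K = "1/2"])
  show "norm (F y - F x) \<le> 1/2 * norm (y - x)" for x y
    using lip_half[of y x] by simp
qed (auto intro: continuous_on_compose2[OF F_continuous[of UNIV]])

text \<open>The trajectory of the autonomous equation g' = F(g) starting at \<open>x\<close>, in
  integral form. \<open>u x 1\<close> is the time-one flow; values outside [0, 1] carry no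
  information.\<close>

definition u :: "'a \<Rightarrow> real \<Rightarrow> 'a" where
  "u x = (SOME g. continuous_on {0..1} g \<and>
     (\<forall>t\<in>{0..1}. g t = x + integral {0..t} (\<lambda>s. F (g s))))"

lemma u_continuous: "continuous_on {0..1} (u x)"
  and u_eq: "t \<in> {0..1} \<Longrightarrow> u x t = x + integral {0..t} (\<lambda>s. F (u x s))"
  using someI_ex[OF trajectory_ex, folded u_def, of x] by auto

lemma Fu_continuous: "continuous_on {0..1} (\<lambda>s. F (u x s))"
  and F'u_continuous: "continuous_on {0..1} (\<lambda>s. F' (u x s))"
  by (rule continuous_on_compose2[OF F_continuous[of UNIV] u_continuous];simp)
    (rule continuous_on_compose2[OF F'_continuous[of UNIV] u_continuous];simp)

lemma norm_F'_comp: "norm (F' x o\<^sub>L A) \<le> norm A / 2"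
proof -
  have "norm (F' x o\<^sub>L A) \<le> 1/2 * norm A"
    by (intro order_trans[OF norm_blinfun_compose] mult_right_mono order_trans[OF bd \<kappa>]) auto
  then show ?thesis by simp
qed

lemma norm_F'_apply: "norm (F' x z) \<le> norm z / 2"
proof -
  have "norm (F' x z) \<le> 1/2 * norm z"
    by (intro order_trans[OF norm_blinfun] mult_right_mono order_trans[OF bd \<kappa>]) auto
  then show ?thesis by simp
qed

lemma variation_ex:
  "\<exists>g. continuous_on {0..1} g \<and>
     (\<forall>t\<in>{0..1}. g t = id_blinfun + integral {0..t} (\<lambda>s. F' (u x s) o\<^sub>L g s))"
proof (rule integral_equation_solution[where f = "\<lambda>s A. F' (u x s) o\<^sub>L A" and K = "1/2"])
  fix s and A B :: "'a \<Rightarrow>\<^sub>L 'a"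
  have "(F' (u x s) o\<^sub>L A) - (F' (u x s) o\<^sub>L B) = F' (u x s) o\<^sub>L (A - B)"
    by (auto intro!: blinfun_eqI simp: blinfun.bilinear_simps)
  then show "norm ((F' (u x s) o\<^sub>L A) - (F' (u x s) o\<^sub>L B)) \<le> 1/2 * norm (A - B)"
    using norm_F'_comp[of "u x s" "A - B"] by simp
qed (auto intro!: continuous_intros F'u_continuous)

text \<open>The solution of the variational equation along \<open>u x\<close>, i.e. the derivative of the flow.\<close>

definition M :: "'a \<Rightarrow> real \<Rightarrow> 'a \<Rightarrow>\<^sub>L 'a" where
  "M x = (SOME g. continuous_on {0..1} g \<and>
     (\<forall>t\<in>{0..1}. g t = id_blinfun + integral {0..t} (\<lambda>s. F' (u x s) o\<^sub>L g s)))"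

lemma M_continuous: "continuous_on {0..1} (M x)"
  and M_eq: "t \<in> {0..1} \<Longrightarrow> M x t = id_blinfun + integral {0..t} (\<lambda>s. F' (u x s) o\<^sub>L M x s)"
  using someI_ex[OF variation_ex, folded M_def, of x] by auto

lemma F'M_continuous: "continuous_on {0..1} (\<lambda>s. F' (u x s) o\<^sub>L M y s)"
  by (intro continuous_intros F'u_continuous M_continuous)

text \<open>The difference of two trajectories has an integrand of at most half its own norm, so
  \<open>contraction_gronwall\<close> applies with \<open>c = 0\<close>.\<close>

lemma u_lipschitz:
  assumes "t \<in> {0..1}"
  shows "norm (u y t - u x t) \<le> 2 * norm (y - x)"
proof -
  have "norm (u y t - u x t) \<le> 2 * (norm (y - x) + 0)"
  proof (rule contraction_gronwall[where g = "\<lambda>s. F (u y s) - F (u x s)"])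
    fix s :: real assume s: "s \<in> {0..1}"
    show "u y s - u x s = y - x + integral {0..s} (\<lambda>s. F (u y s) - F (u x s))"
      by (simp add: u_eq[OF s] integral_diff integrable_upto[OF Fu_continuous s])
    show "norm (F (u y s) - F (u x s)) \<le> 0 + norm (u y s - u x s) / 2"
      using lip_half by simp
  qed (use assms in \<open>auto intro!: continuous_intros u_continuous Fu_continuous\<close>)
  then show ?thesis by simp
qed

lemma M_bound:
  assumes "t \<in> {0..1}"
  shows "norm (M x t) \<le> 2"
proof -
  have "norm (M x t) \<le> 2 * (norm (id_blinfun :: 'a \<Rightarrow>\<^sub>L 'a) + 0)"
  proof (rule contraction_gronwall[where g = "\<lambda>s. F' (u x s) o\<^sub>L M x s"])
    show "norm (F' (u x s) o\<^sub>L M x s) \<le> 0 + norm (M x s) / 2" for s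
      using norm_F'_comp[of "u x s" "M x s"] by simp
  qed (rule M_continuous F'M_continuous M_eq assms | assumption)+
  also have "norm (id_blinfun :: 'a \<Rightarrow>\<^sub>L 'a) \<le> 1"
    by (rule norm_blinfun_bound) auto
  finally show ?thesis by simp
qed

lemma u_near:
  assumes "\<And>z. norm (F z) \<le> B" "t \<in> {0..1}"
  shows "norm (u x t - x) \<le> B"
  unfolding u_eq[OF assms(2)] by (simp add: integral_upto_bound[OF Fu_continuous assms(2)] assms(1))

text \<open>Uniqueness at a rest point: since \<open>F x = 0\<close>, the norm of
  \<open>F (u x s)\<close> is at most half the displacement, and the initial displacement is 0. This
  is what preserves the boundary condition.\<close>

lemma u_rest:
  assumes "F x = 0" "t \<in> {0..1}"
  shows "u x t = x"
proof -
  have "norm (u x t - x) \<le> 2 * (norm (0 :: 'a) + 0)"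
  proof (rule contraction_gronwall[where g = "\<lambda>s. F (u x s)"])
    show "norm (F (u x s)) \<le> 0 + norm (u x s - x) / 2" for s
      using lip_half[of "u x s" x] assms by simp
    show "u x s - x = 0 + integral {0..s} (\<lambda>s. F (u x s))" if "s \<in> {0..1}" for s
      by (simp add: u_eq[OF that])
  qed (use assms in \<open>auto intro!: continuous_intros u_continuous Fu_continuous\<close>)
  then show ?thesis by simp
qed

text \<open>The remainder is the integral of \<open>F (u x s) - F x\<close>. The trajectory moves by
  at most \<open>B\<close> in unit time, and \<open>F\<close> has Lipschitz constant
  \<kappa>.\<close>

lemma u_first_order:
  assumes "\<And>z. norm (F z) \<le> B"
  shows "norm (u x 1 - x - F x) \<le> \<kappa> * B"
proof -
  have "u x 1 - x - F x = integral {0..1} (\<lambda>s. F (u x s) - F x)"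
    using u_eq[of 1 x] integrable_upto[OF Fu_continuous, of 1 x] by (simp add: integral_diff integrable_const_ivl)
  moreover have "norm (integral {0..1} (\<lambda>s. F (u x s) - F x)) \<le> \<kappa> * B"
  proof (rule integral_upto_bound)
    fix s :: real assume "s \<in> {0..1}"
    then have "\<kappa> * norm (u x s - x) \<le> \<kappa> * B"
      by (intro mult_left_mono u_near assms \<kappa>_ge_0)
    with lip[of "u x s" x] show "norm (F (u x s) - F x) \<le> \<kappa> * B"
      by linarith
  qed (auto intro!: continuous_intros Fu_continuous)
  ultimately show ?thesis by simp
qed

lemma M_near:
  assumes "t \<in> {0..1}"
  shows "norm (M x t - id_blinfun) \<le> 2 * \<kappa>"
proof -
  have "norm (F' (u x s) o\<^sub>L M x s) \<le> 2 * \<kappa>" if "s \<in> {0..1}" for s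
    using order_trans[OF norm_blinfun_compose mult_mono[OF bd M_bound[OF that]]] \<kappa>_ge_0
    by (simp add: mult.commute)
  then show ?thesis
    unfolding M_eq[OF assms] add_diff_cancel_left'
    by (rule integral_upto_bound[OF F'M_continuous assms])
qed

text \<open>Compares the flow derivative with one Euler step. The oscillation of \<open>F'\<close>
  matters only within distance \<open>B\<close> of \<open>x\<close>, where the trajectory
  stays.\<close>

lemma M_first_order:
  assumes "\<And>z. norm (F z) \<le> B" and "\<And>y. norm (y - x) \<le> B \<Longrightarrow> norm (F' y - F' x) \<le> \<epsilon>"
  shows "norm (M x 1 - id_blinfun - F' x) \<le> 2 * \<epsilon> + 2 * \<kappa>\<^sup>2"
proof -
  have "M x 1 - id_blinfun - F' x = integral {0..1} (\<lambda>s. (F' (u x s) o\<^sub>L M x s) - F' x)"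
    using M_eq[of 1 x] integrable_upto[OF F'M_continuous, of 1 x x] by (simp add: integral_diff integrable_const_ivl)
  moreover have "norm (integral {0..1} (\<lambda>s. (F' (u x s) o\<^sub>L M x s) - F' x)) \<le> 2 * \<epsilon> + 2 * \<kappa>\<^sup>2"
  proof (rule integral_upto_bound)
    fix s :: real assume s: "s \<in> {0..1}"
    have F'': "norm (F' (u x s) - F' x) \<le> \<epsilon>"
      using assms s u_near by blast
    then have "0 \<le> \<epsilon>" using norm_ge_zero order_trans by blast
    \<comment> \<open>The first summand sees the variation of \<open>F'\<close> along the
      trajectory, the second the drift of \<open>M\<close> away from the identity, which
      \<open>M_near\<close> bounds by 2\<kappa>.\<close>
    have "(F' (u x s) o\<^sub>L M x s) - F' x =
        ((F' (u x s) - F' x) o\<^sub>L M x s) + (F' x o\<^sub>L (M x s - id_blinfun))"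
      by (auto intro!: blinfun_eqI simp: blinfun.bilinear_simps)
    moreover have "norm ((F' (u x s) - F' x) o\<^sub>L M x s) \<le> \<epsilon> * 2"
      by (intro order_trans[OF norm_blinfun_compose] mult_mono F'' M_bound s) (use \<open>0 \<le> \<epsilon>\<close> in auto)
    moreover have "norm (F' x o\<^sub>L (M x s - id_blinfun)) \<le> \<kappa> * (2 * \<kappa>)"
      by (intro order_trans[OF norm_blinfun_compose] mult_mono bd M_near s) (use \<kappa>_ge_0 in auto)
    ultimately show "norm ((F' (u x s) o\<^sub>L M x s) - F' x) \<le> 2 * \<epsilon> + 2 * \<kappa>\<^sup>2"
      using norm_triangle_ineq[of "(F' (u x s) - F' x) o\<^sub>L M x s" "F' x o\<^sub>L (M x s - id_blinfun)"]
      by (simp add: power2_eq_square)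
  qed (auto intro!: continuous_intros F'M_continuous)
  ultimately show ?thesis by simp
qed

text \<open>The mean value inequality on the segment from \<open>a\<close> to \<open>b\<close>,
  applied to \<open>F\<close> minus its linear part at \<open>a\<close>.\<close>

lemma F_taylor:
  assumes "\<And>c. norm (c - a) \<le> norm (b - a) \<Longrightarrow> norm (F' c - F' a) \<le> \<epsilon>"
  shows "norm (F b - F a - F' a (b - a)) \<le> \<epsilon> * norm (b - a)"
proof -
  have "norm ((F b - F' a b) - (F a - F' a a)) \<le> \<epsilon> * norm (b - a)"
  proof (rule differentiable_bound[of "closed_segment a b" "\<lambda>x. F x - F' a x" "\<lambda>x z. (F' x - F' a) z"])
    fix c assume "c \<in> closed_segment a b"
    then have "norm (c - a) \<le> norm (b - a)"
      using segment_bound(1) by (metis norm_minus_commute)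
    then show "onorm (\<lambda>z. (F' c - F' a) z) \<le> \<epsilon>"
      using assms by (simp flip: norm_blinfun.rep_eq)
    show "((\<lambda>x. F x - F' a x) has_derivative (\<lambda>z. (F' c - F' a) z)) (at c within closed_segment a b)"
      by (auto intro!: derivative_eq_intros has_derivative_at_withinI[OF der] simp: blinfun.diff_left)
  qed auto
  then show ?thesis
    by (simp add: blinfun.diff_right algebra_simps)
qed

text \<open>The error \<open>u y - u x - M x (y - x)\<close> solves the variational equation up to a Taylor
  remainder of \<open>F\<close>, so the contraction bounds it.\<close>

lemma u_linearization:
  assumes \<epsilon>: "\<And>a b. norm (b - a) \<le> 2 * norm (y - x) \<Longrightarrow> norm (F' b - F' a) \<le> \<epsilon>"
  shows "norm (u y 1 - u x 1 - M x 1 (y - x)) \<le> 4 * \<epsilon> * norm (y - x)"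
proof -
  define z where "z = y - x"
  define g where "g s = F (u y s) - F (u x s) - F' (u x s) (M x s z)" for s
  have "0 \<le> \<epsilon>" using \<epsilon>[of x x] by simp
  have g: "continuous_on {0..1} g"
    unfolding g_def by (intro continuous_intros Fu_continuous F'u_continuous M_continuous)
  have "norm (u y 1 - u x 1 - M x 1 z) \<le> 2 * (norm (0::'a) + \<epsilon> * (2 * norm z))"
  proof (rule contraction_gronwall[OF _ g])
    fix t :: real assume t: "t \<in> {0..1}"
    have "M x t z = z + integral {0..t} (\<lambda>s. (F' (u x s) o\<^sub>L M x s) z)"
      using t blinfun_apply_integral[OF integrable_upto[OF F'M_continuous t]]
      by (simp add: M_eq[OF t] blinfun.bilinear_simps)
    moreover have "(\<lambda>s. (F' (u x s) o\<^sub>L M x s) z) integrable_on {0..t}"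
      by (intro integrable_upto continuous_intros F'M_continuous t)
    ultimately show "u y t - u x t - M x t z = 0 + integral {0..t} g"
      unfolding g_def
      by (simp add: u_eq[OF t] integral_diff integrable_diff
          integrable_upto[OF Fu_continuous t] z_def)
  next
    fix s :: real assume s: "s \<in> {0..1}"
    \<comment> \<open>The first bracket is the Taylor remainder between the two trajectories, at
      distance at most \<open>2 * norm z\<close>; the second summand is the linear equation acting
      on the error itself.\<close>
    have "g s = (F (u y s) - F (u x s) - F' (u x s) (u y s - u x s))
        + F' (u x s) (u y s - u x s - M x s z)"
      by (simp add: g_def blinfun.bilinear_simps)
    moreover have "norm (F (u y s) - F (u x s) - F' (u x s) (u y s - u x s)) \<le> \<epsilon> * norm (u y s - u x s)"
      using u_lipschitz[OF s, of y x] by (intro F_taylor \<epsilon>) auto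
    moreover have "\<epsilon> * norm (u y s - u x s) \<le> \<epsilon> * (2 * norm z)"
      using u_lipschitz[OF s, of y x] \<open>0 \<le> \<epsilon>\<close> by (intro mult_left_mono) (auto simp: z_def)
    moreover have "norm (F' (u x s) (u y s - u x s - M x s z)) \<le> norm (u y s - u x s - M x s z) / 2"
      by (rule norm_F'_apply)
    ultimately show "norm (g s) \<le> \<epsilon> * (2 * norm z) + norm (u y s - u x s - M x s z) / 2"
      by (smt (verit) norm_triangle_ineq)
  qed (auto intro!: continuous_intros u_continuous M_continuous)
  then show ?thesis by (simp add: z_def)
qed

lemma F'_modulus:
  assumes "0 < \<epsilon>"
  obtains \<delta> where "0 < \<delta>" "\<And>a b. norm (b - a) \<le> \<delta> \<Longrightarrow> norm (F' b - F' a) \<le> \<epsilon>"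
proof -
  obtain d where "d > 0" and d: "\<And>a b. dist b a < d \<Longrightarrow> dist (F' b) (F' a) < \<epsilon>"
    by (rule uniformly_continuous_onE[OF uc assms]) (metis UNIV_I)
  show ?thesis
  proof (rule that[of "d/2"])
    fix a b :: 'a assume "norm (b - a) \<le> d/2"
    then have "dist b a < d"
      using \<open>d > 0\<close> by (simp add: dist_norm)
    from d[OF this] show "norm (F' b - F' a) \<le> \<epsilon>"
      by (simp add: dist_norm)
  qed (use \<open>d > 0\<close> in simp)
qed

lemma flow_has_derivative: "((\<lambda>x. u x 1) has_derivative M x 1) (at x)"
  unfolding has_derivative_at_alt
proof (intro conjI allI impI)
  fix e :: real assume "0 < e"
  \<comment> \<open>\<open>u_linearization\<close> loses a factor 4 and compares points up to twice
    the initial distance apart; hence \<open>e / 4\<close> here and \<delta>/2 below.\<close>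
  then obtain \<delta> where \<delta>: "0 < \<delta>" "\<And>a b. norm (b - a) \<le> \<delta> \<Longrightarrow> norm (F' b - F' a) \<le> e / 4"
    using F'_modulus[of "e/4"] by auto
  have "norm (u y 1 - u x 1 - M x 1 (y - x)) \<le> e * norm (y - x)" if "norm (y - x) < \<delta> / 2" for y
    using u_linearization[of y x "e/4"] \<delta> that by auto
  then show "\<exists>d>0. \<forall>y. norm (y - x) < d \<longrightarrow>
      norm (u y 1 - u x 1 - M x 1 (y - x)) \<le> e * norm (y - x)"
    using \<delta> by (intro exI[of _ "\<delta>/2"]) auto
qed (rule blinfun.bounded_linear_right)

text \<open>The difference of two variational solutions satisfies the same linear equation with a
  source: the change of coefficient between the trajectories times \<open>M y\<close>. The source is
  at most 2\<epsilon> by \<open>M_bound\<close>. This gives continuity of the flow derivative in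
  space.\<close>

lemma M_modulus:
  assumes \<epsilon>: "\<And>a b. norm (b - a) \<le> 2 * norm (y - x) \<Longrightarrow> norm (F' b - F' a) \<le> \<epsilon>"
  shows "norm (M y 1 - M x 1) \<le> 4 * \<epsilon>"
proof -
  have "0 \<le> \<epsilon>" using \<epsilon>[of x x] by simp
  have "norm (M y 1 - M x 1) \<le> 2 * (norm (0 :: 'a \<Rightarrow>\<^sub>L 'a) + \<epsilon> * 2)"
  proof (rule contraction_gronwall[where g = "\<lambda>s. (F' (u y s) o\<^sub>L M y s) - (F' (u x s) o\<^sub>L M x s)"])
    fix t :: real assume t: "t \<in> {0..1}"
    show "M y t - M x t =
        0 + integral {0..t} (\<lambda>s. (F' (u y s) o\<^sub>L M y s) - (F' (u x s) o\<^sub>L M x s))"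
      by (simp add: M_eq[OF t] integral_diff integrable_upto[OF F'M_continuous t])
  next
    fix s :: real assume s: "s \<in> {0..1}"
    have "(F' (u y s) o\<^sub>L M y s) - (F' (u x s) o\<^sub>L M x s) =
        ((F' (u y s) - F' (u x s)) o\<^sub>L M y s) + (F' (u x s) o\<^sub>L (M y s - M x s))"
      by (auto intro!: blinfun_eqI simp: blinfun.bilinear_simps)
    moreover have "norm ((F' (u y s) - F' (u x s)) o\<^sub>L M y s) \<le> \<epsilon> * 2"
      by (intro order_trans[OF norm_blinfun_compose] mult_mono \<epsilon> M_bound u_lipschitz s)
        (use \<open>0 \<le> \<epsilon>\<close> in auto)
    ultimately show "norm ((F' (u y s) o\<^sub>L M y s) - (F' (u x s) o\<^sub>L M x s))
        \<le> \<epsilon> * 2 + norm (M y s - M x s) / 2"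
      using norm_F'_comp[of "u x s" "M y s - M x s"] by (smt (verit) norm_triangle_ineq)
  qed (auto intro!: continuous_intros M_continuous F'M_continuous)
  then show ?thesis by simp
qed

lemma M_continuous_space: "continuous_on UNIV (\<lambda>x. M x 1)"
  unfolding continuous_on_iff
proof safe
  fix x :: 'a and e :: real assume "0 < e"
  then obtain \<delta> where \<delta>: "0 < \<delta>" "\<And>a b. norm (b - a) \<le> \<delta> \<Longrightarrow> norm (F' b - F' a) \<le> e / 8"
    using F'_modulus[of "e/8"] by auto
  have "dist (M y 1) (M x 1) < e" if "dist y x < \<delta> / 2" for y
    using M_modulus[of y x "e/8"] \<delta> that \<open>0 < e\<close> by (force simp: dist_norm)
  then show "\<exists>d>0. \<forall>x'\<in>UNIV. dist x' x < d \<longrightarrow> dist (M x' 1) (M x 1) < e"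
    using \<delta> by (intro exI[of _ "\<delta>/2"]) auto
qed

lemma M_has_vector_derivative:
  assumes "t \<in> {0..1}"
  shows "(M x has_vector_derivative (F' (u x t) o\<^sub>L M x t)) (at t within {0..1})"
proof -
  have "((\<lambda>t. id_blinfun + integral {0..t} (\<lambda>s. F' (u x s) o\<^sub>L M x s))
      has_vector_derivative (F' (u x t) o\<^sub>L M x t)) (at t within {0..1})"
    by (auto intro!: derivative_eq_intros integral_has_vector_derivative F'M_continuous assms)
  then show ?thesis
    by (rule has_vector_derivative_transform[OF assms, rotated]) (simp add: M_eq)
qed

end

section \<open>Liouville's formula in dimension three\<close>

text \<open>For a matrix solution of a' = A a, the determinant has derivative tr(A) det(a), which
  vanishes here. In dimension three this follows from expanding the determinant.\<close>

lemma det_linear_ode_const: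
  fixes a A :: "3 \<Rightarrow> 3 \<Rightarrow> real \<Rightarrow> real"
  assumes der: "\<And>i j t. t \<in> {0..1} \<Longrightarrow>
      (a i j has_real_derivative (\<Sum>k\<in>UNIV. A i k t * a k j t)) (at t within {0..1})"
    and trace: "\<And>t. t \<in> {0..1} \<Longrightarrow> (\<Sum>i\<in>UNIV. A i i t) = 0"
  shows "det (\<chi> i j. a i j 1) = det (\<chi> i j. a i j 0)"
proof -
  have "((\<lambda>t. det (\<chi> i j. a i j t)) has_real_derivative 0) (at t within {0..1})" if t: "t \<in> {0..1}" for t
  proof -
    \<comment> \<open>Solving the trace condition for one diagonal entry lets the expanded
      derivative cancel as a polynomial identity.\<close>
    have "A 1 1 t = - A 2 2 t - A 3 3 t"
      using trace[OF t] by (simp add: sum_3)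
    then show ?thesis
      unfolding det_3 vec_lambda_beta
      by (auto intro!: derivative_eq_intros der[OF t])
        (simp only: sum_3, simp add: algebra_simps)
  qed
  then obtain c where "\<forall>t\<in>{0..1}. det (\<chi> i j. a i j t) = c"
    using has_field_derivative_zero_constant[of "{0..1::real}" "\<lambda>t. det (\<chi> i j. a i j t)"] by auto
  then show ?thesis
    by simp
qed

text \<open>\<open>M x\<close> starts at the identity and solves a linear equation whose coefficient
  has zero trace. The trace condition concerns only the trajectory of \<open>x\<close>, so a field
  that is divergence free merely near that trajectory qualifies.\<close>

lemma flow_det:
  fixes F :: "real^3 \<Rightarrow> real^3"
  assumes "small_field F F' \<kappa>"
    and trace: "\<And>t. t \<in> {0..1} \<Longrightarrow> (\<Sum>i\<in>UNIV. F' (small_field.u F x t) (axis i 1) $ i) = 0"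
  shows "det (matrix (small_field.M F F' x 1)) = 1"
proof -
  interpret small_field F F' \<kappa> by fact
  define a where "a i j t = M x t (axis j 1) $ i" for i j t
  define A where "A i j t = F' (u x t) (axis j 1) $ i" for i j t
  have "(a i j has_real_derivative (\<Sum>k\<in>UNIV. A i k t * a k j t)) (at t within {0..1})"
    if "t \<in> {0..1}" for i j t
  proof -
    have "bounded_linear (\<lambda>B :: (real^3) \<Rightarrow>\<^sub>L (real^3). B (axis j 1) $ i)"
      by (intro bounded_linear_compose[OF bounded_linear_vec_nth] blinfun.bounded_linear_left)
    from bounded_linear.has_vector_derivative[OF this M_has_vector_derivative[OF that, of x]]
    have "(a i j has_vector_derivative F' (u x t) (M x t (axis j 1)) $ i) (at t within {0..1})"
      by (simp add: a_def[abs_def])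
    \<comment> \<open>Expanding the column \<open>M x t (axis j 1)\<close> in the standard basis
      turns the operator equation into the entrywise matrix equation.\<close>
    moreover have "F' (u x t) (M x t (axis j 1)) = F' (u x t) (\<Sum>k\<in>UNIV. a k j t *\<^sub>R axis k 1)"
      by (simp add: a_def basis_expansion scalar_mult_eq_scaleR[symmetric])
    ultimately show ?thesis
      by (simp add: has_real_derivative_iff_has_vector_derivative blinfun.sum_right blinfun.scaleR_right
        A_def mult.commute)
  qed
  then have "det (\<chi> i j. a i j 1) = det (\<chi> i j. a i j 0)"
    by (rule det_linear_ode_const) (use trace in \<open>simp_all add: A_def\<close>)
  also have "(\<chi> i j. a i j 0) = mat 1"
    by (simp add: a_def M_eq vec_eq_iff mat_def axis_def)
  finally show ?thesis
    by (simp add: matrix_def a_def)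
qed

subsection \<open>A continuously differentiable cutoff\<close>

lemma has_derivative_of_quadratic_error:
  fixes f :: "'a::real_normed_vector \<Rightarrow> 'b::real_normed_vector"
  assumes "bounded_linear D" "\<And>y. norm (f y - f x - D (y - x)) \<le> (norm (y - x))\<^sup>2"
  shows "(f has_derivative D) (at x)"
  unfolding has_derivative_at_alt
proof (intro conjI allI impI)
  fix e :: real assume "0 < e"
  moreover have "norm (f y - f x - D (y - x)) \<le> e * norm (y - x)" if "norm (y - x) < e" for y
    using assms(2)[of y] that mult_right_mono[of "norm (y - x)" e "norm (y - x)"]
    by (simp add: power2_eq_square)
  ultimately show "\<exists>d>0. \<forall>y. norm (y - x) < d \<longrightarrow> norm (f y - f x - D (y - x)) \<le> e * norm (y - x)"
    by blast
qed (fact assms)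

text \<open>Squaring the positive part removes its kink, so this is the elementary C^1 building
  block of the cutoff. The Taylor error is at most \<open>(y - t)\<^sup>2\<close> in each
  combination of signs.\<close>

lemma pos_part_square_has_derivative:
  "((\<lambda>t::real. (max 0 t)\<^sup>2) has_derivative (\<lambda>h. 2 * max 0 t * h)) (at t)"
proof (rule has_derivative_of_quadratic_error)
  fix y
  have sq: "(y - t)\<^sup>2 = y\<^sup>2 - 2 * (t * y) + t\<^sup>2"
    by (simp add: power2_diff)
  have "y\<^sup>2 - 2 * (t * y) \<le> (y - t)\<^sup>2"
    unfolding sq using zero_le_power2[of t] by linarith
  moreover have "y\<^sup>2 \<le> (y - t)\<^sup>2" if "t \<le> 0" "0 \<le> y"
    unfolding sq using mult_nonpos_nonneg[OF that] zero_le_power2[of t] by linarith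
  moreover have "0 \<le> t\<^sup>2 - 2 * (t * y)" "t\<^sup>2 - 2 * (t * y) \<le> (y - t)\<^sup>2" if "0 \<le> t" "y \<le> 0"
    unfolding sq using mult_nonneg_nonpos[OF that] zero_le_power2[of t] zero_le_power2[of y] by linarith+
  moreover have "0 \<le> y\<^sup>2 - 2 * (t * y) + t\<^sup>2"
    unfolding sq[symmetric] by simp
  ultimately show "norm ((max 0 y)\<^sup>2 - (max 0 t)\<^sup>2 - 2 * max 0 t * (y - t)) \<le> (norm (y - t))\<^sup>2"
    by (cases "0 \<le> t"; cases "0 \<le> y")
      (auto simp: max_def power2_diff power2_eq_square algebra_simps abs_le_iff)
qed (rule bounded_linear_mult_right)

text \<open>For positive \<open>r\<close> the bump is positive exactly on the open ball.
  Representing the derivative by a gradient vector reduces its continuity to that of the vector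
  field \<open>d\<close>.\<close>

lemma ball_bump:
  fixes c :: "'a::euclidean_space"
  obtains d where "\<And>x. ((\<lambda>x. (max 0 (r\<^sup>2 - (x - c) \<bullet> (x - c)))\<^sup>2) has_derivative (\<bullet>) (d x)) (at x)"
    "continuous_on UNIV d"
proof
  let ?d = "\<lambda>x. (- 4 * max 0 (r\<^sup>2 - (x - c) \<bullet> (x - c))) *\<^sub>R (x - c)"
  show "((\<lambda>x. (max 0 (r\<^sup>2 - (x - c) \<bullet> (x - c)))\<^sup>2) has_derivative (\<bullet>) (?d x)) (at x)" for x
  proof -
    have "((\<lambda>x. r\<^sup>2 - (x - c) \<bullet> (x - c)) has_derivative (\<lambda>h. - 2 * ((x - c) \<bullet> h))) (at x)"
      by (auto intro!: derivative_eq_intros simp: inner_commute)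
    from has_derivative_compose[OF this pos_part_square_has_derivative]
    show ?thesis
      by (rule has_derivative_eq_rhs) auto
  qed
qed (intro continuous_intros)

text \<open>A sum \<open>\<Psi>\<close> of bumps over a finite cover exceeds some \<open>m > 0\<close> on \<open>K\<close>; composing with a \<open>C\<^sup>1\<close>
  function that is \<open>0\<close> at \<open>0\<close> and \<open>1\<close> from \<open>m\<close> on makes it constant near \<open>K\<close>.\<close>

lemma C1_cutoff:
  fixes K :: "'a::euclidean_space set"
  assumes "compact K" "open U" "K \<subseteq> U"
  obtains \<eta> :: "'a \<Rightarrow> real" and d V L
  where "\<And>x. (\<eta> has_derivative (\<bullet>) (d x)) (at x)" "continuous_on UNIV d"
    "open V" "K \<subseteq> V" "compact L" "V \<subseteq> L" "L \<subseteq> U"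
    "\<And>x. x \<in> V \<Longrightarrow> \<eta> x = 1" "\<And>x. x \<notin> L \<Longrightarrow> \<eta> x = 0"
proof -
  have "\<exists>r>0. cball x r \<subseteq> U" if "x \<in> K" for x
    using assms that open_contains_cball by blast
  then obtain r where r: "\<And>x. x \<in> K \<Longrightarrow> 0 < r x" "\<And>x. x \<in> K \<Longrightarrow> cball x (r x) \<subseteq> U"
    by metis
  obtain C where C: "C \<subseteq> K" "finite C" "K \<subseteq> (\<Union>c\<in>C. ball c (r c))"
    by (rule compactE_image[OF assms(1), of K "\<lambda>c. ball c (r c)"]) (use r in auto)
  define L where "L = (\<Union>c\<in>C. cball c (r c))"
  define \<psi> where "\<psi> c x = (max 0 ((r c)\<^sup>2 - (x - c) \<bullet> (x - c)))\<^sup>2" for c x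
  have "\<exists>d. (\<forall>x. (\<psi> c has_derivative (\<bullet>) (d x)) (at x)) \<and> continuous_on UNIV d" for c
    unfolding \<psi>_def using ball_bump by metis
  then obtain d where d: "\<And>c x. (\<psi> c has_derivative (\<bullet>) (d c x)) (at x)"
      "\<And>c. continuous_on UNIV (d c)"
    by metis
  define \<Psi> where "\<Psi> x = (\<Sum>c\<in>C. \<psi> c x)" for x
  have der_\<Psi>: "(\<Psi> has_derivative (\<lambda>h. (\<Sum>c\<in>C. d c x) \<bullet> h)) (at x)" for x
    unfolding \<Psi>_def by (auto intro!: derivative_eq_intros d simp: inner_sum_left)
  have cont_\<Psi>: "continuous_on A \<Psi>" for A
    by (rule has_derivative_continuous_on[OF has_derivative_at_withinI[OF der_\<Psi>]])
  have \<psi>_iff: "0 < \<psi> c x \<longleftrightarrow> x \<in> ball c (r c)" if "c \<in> K" for c x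
  proof -
    have "dist c x < r c \<longleftrightarrow> (dist c x)\<^sup>2 < (r c)\<^sup>2"
      using r(1)[OF that] power_mono_iff[of "r c" "dist c x" 2] by (auto simp flip: not_le)
    moreover have "(dist c x)\<^sup>2 = (x - c) \<bullet> (x - c)"
      unfolding dist_commute[of c] by (simp add: dist_norm power2_norm_eq_inner)
    ultimately show ?thesis
      by (auto simp: \<psi>_def max_def)
  qed
  have \<psi>_nonneg: "0 \<le> \<psi> c x" for c x
    by (simp add: \<psi>_def)
  have \<Psi>_pos: "0 < \<Psi> x" if "x \<in> K" for x
  proof -
    obtain c where c: "c \<in> C" "x \<in> ball c (r c)"
      using C(3) \<open>x \<in> K\<close> by blast
    with C(1) have "0 < \<psi> c x"
      using \<psi>_iff by blast
    then show ?thesis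
      unfolding \<Psi>_def by (rule sum_pos2[OF C(2) c(1)]) (rule \<psi>_nonneg)
  qed
  have \<Psi>_zero: "\<Psi> x = 0" if "x \<notin> L" for x
    unfolding \<Psi>_def
  proof (intro sum.neutral ballI)
    fix c assume "c \<in> C"
    then have "x \<notin> ball c (r c)" "c \<in> K"
      using that C(1) by (auto simp: L_def)
    then have "\<not> 0 < \<psi> c x"
      using \<psi>_iff by blast
    then show "\<psi> c x = 0" using \<psi>_nonneg[of c x] by simp
  qed
  \<comment> \<open>Half the minimum of \<Psi> on \<open>K\<close> makes the inequality strict, so
    that the open set \<open>V\<close> below contains \<open>K\<close>. For empty \<open>K\<close>
    any positive value serves.\<close>
  obtain m where m: "0 < m" "\<And>x. x \<in> K \<Longrightarrow> m < \<Psi> x"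
  proof (cases "K = {}")
    case False
    then obtain z where "z \<in> K" "\<And>x. x \<in> K \<Longrightarrow> \<Psi> z \<le> \<Psi> x"
      using continuous_attains_inf[OF assms(1) _ cont_\<Psi>] by blast
    then have "\<Psi> z / 2 < \<Psi> x" if "x \<in> K" for x
      using \<Psi>_pos[of z] that by force
    then show ?thesis
      using \<Psi>_pos[OF \<open>z \<in> K\<close>] by (intro that[of "\<Psi> z / 2"]) auto
  qed (use that[of 1] in auto)
  \<comment> \<open>The outer function s |-> 1 - (max 0 (1 - s/m))^2 is C^1, vanishes at 0 and
    equals 1 from m on.\<close>
  define \<eta> where "\<eta> x = 1 - (max 0 (1 - \<Psi> x / m))\<^sup>2" for x
  define D where "D x = (2 * max 0 (1 - \<Psi> x / m) / m) *\<^sub>R (\<Sum>c\<in>C. d c x)" for x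
  define V where "V = {x. m < \<Psi> x}"
  show ?thesis
  proof
    show "(\<eta> has_derivative (\<bullet>) (D x)) (at x)" for x
    proof -
      have "((\<lambda>x. 1 - \<Psi> x / m) has_derivative (\<lambda>h. - ((\<Sum>c\<in>C. d c x) \<bullet> h) / m)) (at x)"
        using m by (auto intro!: derivative_eq_intros der_\<Psi>)
      from has_derivative_diff[OF has_derivative_const[of 1]
          has_derivative_compose[OF this pos_part_square_has_derivative]]
      show ?thesis
        unfolding \<eta>_def by (rule has_derivative_eq_rhs) (auto simp: D_def)
    qed
    show "continuous_on UNIV D"
      unfolding D_def using m by (intro continuous_intros cont_\<Psi> d(2)) auto
    show "open V"
      unfolding V_def by (intro open_Collect_less continuous_intros cont_\<Psi>)
    show "K \<subseteq> V" using m by (auto simp: V_def)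
    show "compact L" using C by (auto simp: L_def)
    show "V \<subseteq> L" using \<Psi>_zero m by (force simp: V_def)
    show "L \<subseteq> U" using r C by (fastforce simp: L_def)
    show "\<eta> x = 1" if "x \<in> V" for x
      using that m by (simp add: \<eta>_def V_def max_def field_simps)
    show "\<eta> x = 0" if "x \<notin> L" for x
      using \<Psi>_zero[OF that] by (simp add: \<eta>_def)
  qed
qed

subsection \<open>Sobolev norms of continuously differentiable maps\<close>

lemma has_derivative_zero_outside:
  fixes g :: "'a::euclidean_space \<Rightarrow> 'b::real_normed_vector"
  assumes "(g has_derivative D) (at x)" "closed K" "x \<notin> K" "\<And>y. y \<notin> K \<Longrightarrow> g y = 0"
  shows "D = (\<lambda>_. 0)"
proof -
  have "(g has_derivative (\<lambda>_. 0)) (at x)"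
    by (rule has_derivative_transform_within_open[OF has_derivative_const[of 0], of "- K"])
      (use assms in auto)
  with assms(1) show ?thesis
    by (rule has_derivative_unique)
qed

lemma integrable_compact_support:
  fixes g :: "'a::euclidean_space \<Rightarrow> 'b::{banach, second_countable_topology}"
  assumes "continuous_on UNIV g" "compact K" "\<And>x. x \<notin> K \<Longrightarrow> g x = 0"
  shows "integrable lborel g"
proof -
  have "integrable lborel (\<lambda>x. indicator K x *\<^sub>R g x)"
    using assms by (intro borel_integrable_compact continuous_on_subset[OF assms(1)]) auto
  moreover have "(\<lambda>x. indicator K x *\<^sub>R g x) = g"
    using assms(3) by (auto simp: indicator_def)
  ultimately show ?thesis by simp
qed

text \<open>By translation invariance all difference quotients of \<open>g\<close> have integral \<open>0\<close>; pass to the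
  limit by dominated convergence.\<close>

lemma integral_directional_derivative_compact_support:
  fixes g :: "'a::euclidean_space \<Rightarrow> real"
  assumes der: "\<And>x. (g has_derivative g' x) (at x)"
    and cont: "continuous_on UNIV (\<lambda>x. g' x e)"
    and K: "compact K" and zero: "\<And>x. x \<notin> K \<Longrightarrow> g x = 0"
  shows "(LINT x|lborel. g' x e) = 0"
proof -
  have zero': "g' x e = 0" if "x \<notin> K" for x
    using has_derivative_zero_outside[OF der compact_imp_closed[OF K] that zero] by simp
  obtain C where C: "\<And>x. x \<in> K \<Longrightarrow> \<bar>g' x e\<bar> \<le> C" "0 < C"
    using compact_imp_bounded[OF compact_continuous_image[OF continuous_on_subset[OF cont subset_UNIV] K]]
    by (auto simp: bounded_pos)
  have C': "\<bar>g' x e\<bar> \<le> C" for x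
    using C zero'[of x] by (cases "x \<in> K") auto
  obtain R where R: "\<And>x. x \<in> K \<Longrightarrow> norm x \<le> R"
    using compact_imp_bounded[OF K] by (auto simp: bounded_iff)
  \<comment> \<open>The shifts \<open>t n *\<^sub>R e\<close> have length at most
    \<open>norm e\<close>. Enlarging the ball around \<open>K\<close> by that much captures the
    supports of all difference quotients, so one integrable majorant suffices.\<close>
  define S where "S = cball (0::'a) (R + norm e)"
  define t :: "nat \<Rightarrow> real" where "t n = inverse (real (Suc n))" for n
  have t: "0 < t n" "t n \<le> 1" for n
    by (auto simp: t_def field_simps)
  define q where "q n x = (g (t n *\<^sub>R e + x) - g x) / t n" for n x
  have gcont: "continuous_on UNIV g"
    by (rule has_derivative_continuous_on[OF has_derivative_at_withinI[OF der]])
  have gmeas [measurable]: "g \<in> borel_measurable borel"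
    by (rule borel_measurable_continuous_onI[OF gcont])
  have line: "((\<lambda>s. g (s *\<^sub>R e + x)) has_real_derivative g' (s *\<^sub>R e + x) e) (at s)" for s x
  proof -
    have "((\<lambda>s. g (s *\<^sub>R e + x)) has_derivative (\<lambda>r. g' (s *\<^sub>R e + x) (r *\<^sub>R e))) (at s)"
      by (rule has_derivative_compose[OF _ der, where f = "\<lambda>s. s *\<^sub>R e + x"])
        (auto intro!: derivative_eq_intros)
    then show ?thesis
      using has_derivative_bounded_linear[OF der]
      by (simp add: has_field_derivative_def bounded_linear.linear linear_scale mult_commute_abs)
  qed
  have bound: "norm (q n x) \<le> C * indicator S x" for n x
  proof (cases "x \<in> S")
    case True
    \<comment> \<open>The mean value theorem turns the quotient into a directional derivative at an
      intermediate point, bounded by \<open>C\<close>.\<close>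
    obtain z where "g (t n *\<^sub>R e + x) - g (0 *\<^sub>R e + x) = (t n - 0) * g' (z *\<^sub>R e + x) e"
      using MVT2[of 0 "t n" "\<lambda>s. g (s *\<^sub>R e + x)" "\<lambda>s. g' (s *\<^sub>R e + x) e"] t line by blast
    then have "q n x = g' (z *\<^sub>R e + x) e"
      using t[of n] by (simp add: q_def)
    then show ?thesis using C' True by simp
  next
    case False
    then have "norm x > R + norm e" by (simp add: S_def)
    moreover have "norm (t n *\<^sub>R e) \<le> norm e"
      using t[of n] by (simp add: mult_left_le_one_le)
    moreover have "norm x \<le> norm (t n *\<^sub>R e + x) + norm (t n *\<^sub>R e)"
      by (metis add_diff_cancel_left' norm_triangle_ineq4 add.commute)
    ultimately have "norm (t n *\<^sub>R e + x) > R" "norm x > R"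
      by (auto simp: add_increasing2 intro: le_less_trans[rotated])
    then have "t n *\<^sub>R e + x \<notin> K" "x \<notin> K"
      using R by (meson not_less)+
    then show ?thesis
      using False zero by (simp add: q_def)
  qed
  have t_lim: "filterlim t (at 0) sequentially"
    using t LIMSEQ_inverse_real_of_nat by (auto simp: filterlim_at t_def[abs_def] less_imp_neq)
  have "(\<lambda>n. q n x) \<longlonglongrightarrow> g' x e" for x
    using filterlim_compose[OF line[of x 0, unfolded DERIV_def] t_lim] by (simp add: q_def)
  moreover have [measurable]: "q n \<in> borel_measurable lborel" for n
    unfolding q_def by measurable
  moreover have "(\<lambda>x. g' x e) \<in> borel_measurable lborel"
    by (simp add: borel_measurable_continuous_onI[OF cont])
  moreover have "integrable lborel (\<lambda>x. C * indicator S x)"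
    by (intro integrable_mult_right integrable_real_indicator)
      (auto simp: S_def emeasure_lborel_cball_finite[unfolded infinity_ennreal_def])
  ultimately have "(\<lambda>n. LINT x|lborel. q n x) \<longlonglongrightarrow> (LINT x|lborel. g' x e)"
    using bound by (intro integral_dominated_convergence[where w = "\<lambda>x. C * indicator S x"]) auto
  moreover have "(LINT x|lborel. q n x) = 0" for n
  proof -
    have int: "integrable lborel g"
      by (rule integrable_compact_support[OF gcont K zero])
    have "integrable lborel (\<lambda>x. g (t n *\<^sub>R e + x))"
      using int integrable_distr_eq[of "(+) (t n *\<^sub>R e)" lborel borel g]
        lborel_distr_plus[of "t n *\<^sub>R e"] by simp
    moreover have "(LINT x|lborel. g (t n *\<^sub>R e + x)) = (LINT x|lborel. g x)"
      using integral_distr[of "(+) (t n *\<^sub>R e)" lborel borel g] lborel_distr_plus[of "t n *\<^sub>R e"]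
      by simp
    ultimately show ?thesis
      unfolding q_def using int by simp
  qed
  ultimately show ?thesis
    by (simp add: LIMSEQ_const_iff)
qed

text \<open>The extension is continuous on the open set \<open>S\<close> and zero on the open
  complement of \<open>K\<close>; these two sets cover the space.\<close>

lemma continuous_on_zero_extension:
  fixes f :: "'a::topological_space \<Rightarrow> 'b::{topological_space, zero}"
  assumes "open S" "closed K" "K \<subseteq> S" "continuous_on S f" "\<And>x. x \<in> S - K \<Longrightarrow> f x = 0"
  shows "continuous_on UNIV (\<lambda>x. if x \<in> S then f x else 0)"
proof -
  let ?g = "\<lambda>x. if x \<in> S then f x else 0"
  have "continuous_on S ?g"
    using assms(4) by (simp cong: continuous_on_cong)
  moreover have "?g x = 0" if "x \<in> - K" for x
    using that assms(5) by auto
  then have "continuous_on (- K) ?g"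
    by (subst continuous_on_cong[OF refl]) auto
  ultimately have "continuous_on (S \<union> - K) ?g"
    using assms by (intro continuous_on_open_Un) auto
  moreover have "S \<union> - K = UNIV" using assms by auto
  ultimately show ?thesis by simp
qed

lemma C1_on_continuous_on: "C1_on S f \<Longrightarrow> continuous_on S f"
  by (auto simp: C1_on_def continuous_at_imp_continuous_on differentiable_imp_continuous_within)

lemma C1_on_has_derivative:
  "C1_on S f \<Longrightarrow> x \<in> S \<Longrightarrow> (f has_derivative (*v) (jacobian f (at x))) (at x)"
  by (simp add: C1_on_def flip: jacobian_works)

lemma C1_on_subset: "C1_on S f \<Longrightarrow> T \<subseteq> S \<Longrightarrow> C1_on T f"
  by (auto simp: C1_on_def intro: continuous_on_subset)

lemma absolutely_integrable_on_compact:
  fixes f :: "'a::euclidean_space \<Rightarrow> 'b::euclidean_space"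
  assumes "compact K" "continuous_on K f"
  shows "f absolutely_integrable_on K"
  using borel_integrable_compact[OF assms]
  by (simp add: set_integrable_def integrable_completion borel_measurable_integrable)

text \<open>Weak gradients are stated with Lebesgue measure on \<open>S\<close>, whereas translation
  invariance is applied to \<open>lborel\<close>. Extension by zero links the two.\<close>

lemma integral_lebesgue_on_eq_lborel:
  fixes f :: "'a::euclidean_space \<Rightarrow> real"
  assumes "open S" "integrable lborel (\<lambda>x. if x \<in> S then f x else 0)"
  shows "(LINT x|lebesgue_on S. f x) = (LINT x|lborel. (if x \<in> S then f x else 0))"
proof -
  have "(LINT x|lebesgue_on S. f x) = (LINT x|lebesgue. (if x \<in> S then f x else 0))"
    using assms(1) by (subst integral_restrict_space) (auto intro!: Bochner_Integration.integral_cong)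
  also have "\<dots> = (LINT x|lborel. (if x \<in> S then f x else 0))"
    using assms(2) by (intro integral_completion borel_measurable_integrable)
  finally show ?thesis .
qed

lemma test_function_C1:
  assumes "test_function S \<phi>"
  shows "\<phi> differentiable (at x)" "continuous_on UNIV (partial_deriv k \<phi>)"
proof -
  have "Ck (Suc 0) \<phi>"
    using assms unfolding test_function_def by blast
  then show "\<phi> differentiable (at x)" "continuous_on UNIV (partial_deriv k \<phi>)"
    by auto
qed

text \<open>The product of a component of \<open>f\<close> with \<phi>, extended by zero, is C^1
  with compact support, so its partial derivative integrates to 0. The product rule splits that
  derivative into the two integrands \<open>p\<close> and \<open>q\<close>.\<close>

lemma C1_on_integration_by_parts:
  fixes f :: "real^'n \<Rightarrow> real^'m"
  assumes S: "open S" and f: "C1_on S f" and \<phi>: "test_function S \<phi>"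
  shows "(LINT x|lebesgue_on S. f x $ i * partial_deriv k \<phi> x) =
    - (LINT x|lebesgue_on S. jacobian f (at x) $ i $ k * \<phi> x)"
proof -
  define K where "K = closure {x. \<phi> x \<noteq> 0}"
  have K: "compact K" "K \<subseteq> S" and zero: "\<And>x. x \<notin> K \<Longrightarrow> \<phi> x = 0"
    using \<phi> closure_subset[of "{x. \<phi> x \<noteq> 0}"] by (auto simp: test_function_def K_def)
  have clK: "closed K" using K compact_imp_closed by blast
  define \<phi>' where "\<phi>' x = frechet_derivative \<phi> (at x)" for x
  have der_\<phi>: "(\<phi> has_derivative \<phi>' x) (at x)" for x
    using test_function_C1(1)[OF \<phi>, of x] by (simp add: \<phi>'_def frechet_derivative_works)
  have zero': "\<phi>' x = (\<lambda>_. 0)" if "x \<notin> K" for x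
    using has_derivative_zero_outside[OF der_\<phi> clK that zero] .
  have \<phi>'_axis: "\<phi>' x (axis k 1) = partial_deriv k \<phi> x" for x
    by (simp add: \<phi>'_def partial_deriv_def)
  define g where "g x = (if x \<in> S then f x $ i * \<phi> x else 0)" for x
  define g' where "g' x h = (if x \<in> S then f x $ i * \<phi>' x h + (jacobian f (at x) *v h) $ i * \<phi> x else 0)" for x h
  define p where "p x = (if x \<in> S then f x $ i * partial_deriv k \<phi> x else 0)" for x
  define q where "q x = (if x \<in> S then jacobian f (at x) $ i $ k * \<phi> x else 0)" for x
  have der: "(g has_derivative g' x) (at x)" for x
  proof (cases "x \<in> S")
    case True
    have "((\<lambda>y. f y $ i) has_derivative (\<lambda>h. (jacobian f (at x) *v h) $ i)) (at x)"
      by (rule bounded_linear.has_derivative[OF bounded_linear_vec_nth C1_on_has_derivative[OF f True]])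
    then have "((\<lambda>y. f y $ i * \<phi> y) has_derivative g' x) (at x)"
      using True by (auto intro!: derivative_eq_intros der_\<phi> simp: g'_def)
    then show ?thesis
      by (rule has_derivative_transform_within_open[OF _ S True]) (simp add: g_def)
  next
    case False
    then have "x \<in> - K" using K by blast
    moreover have "g' x = (\<lambda>_. 0)" using False by (auto simp: g'_def)
    ultimately show ?thesis
      using clK zero
      by (auto simp: g_def intro!: has_derivative_transform_within_open[OF has_derivative_const[of 0], of "- K"])
  qed
  have cont_\<phi>: "continuous_on A \<phi>" "continuous_on A (partial_deriv k \<phi>)" for A
    using test_function_C1(2)[OF \<phi>] continuous_on_subset
      has_derivative_continuous_on[OF has_derivative_at_withinI[OF der_\<phi>]] by blast+
  have cont_J: "continuous_on S (\<lambda>x. jacobian f (at x))"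
    using f by (simp add: C1_on_def)
  have cont_p: "continuous_on UNIV p"
    unfolding p_def using zero' \<phi>'_axis
    by (intro continuous_on_zero_extension[OF S clK] K continuous_intros C1_on_continuous_on f cont_\<phi>)
      (auto simp flip: \<phi>'_axis)
  have cont_q: "continuous_on UNIV q"
    unfolding q_def using zero
    by (intro continuous_on_zero_extension[OF S clK] K continuous_intros cont_J cont_\<phi>) auto
  have int_p: "integrable lborel p"
    by (rule integrable_compact_support[OF cont_p K(1)]) (simp add: p_def zero' flip: \<phi>'_axis)
  have int_q: "integrable lborel q"
    by (rule integrable_compact_support[OF cont_q K(1)]) (simp add: q_def zero)
  have g'_eq: "g' x (axis k 1) = p x + q x" for x
    by (simp add: g'_def p_def q_def \<phi>'_axis matrix_vector_mul_component inner_axis)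
  have "(LINT x|lborel. g' x (axis k 1)) = 0"
    by (rule integral_directional_derivative_compact_support[OF der _ K(1)])
      (auto simp: g'_eq g_def zero intro!: continuous_intros cont_p cont_q)
  then have "(LINT x|lborel. p x) = - (LINT x|lborel. q x)"
    using int_p int_q by (simp add: g'_eq)
  then show ?thesis
    using integral_lebesgue_on_eq_lborel[OF S] int_p int_q unfolding p_def q_def by simp
qed

lemma C1_on_has_weak_gradient:
  fixes f :: "real^'n \<Rightarrow> real^'m"
  assumes "open S" "C1_on S f"
  shows "has_weak_gradient S f (\<lambda>x. jacobian f (at x))"
  unfolding has_weak_gradient_def
proof (intro conjI allI impI; (elim conjE)?)
  fix K assume "compact K" "K \<subseteq> S"
  then show "f absolutely_integrable_on K" "(\<lambda>x. jacobian f (at x)) absolutely_integrable_on K"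
    using assms C1_on_continuous_on[OF assms(2)]
    by (auto intro!: absolutely_integrable_on_compact intro: continuous_on_subset simp: C1_on_def)
qed (rule C1_on_integration_by_parts[OF assms])

section \<open>Lebesgue and Sobolev norms from pointwise bounds\<close>

lemma bounded_continuous_in_Lp_space:
  fixes f :: "real^'n \<Rightarrow> 'b::euclidean_space"
  assumes "open S" "bounded S" "continuous_on S f" "\<And>x. x \<in> S \<Longrightarrow> norm (f x) \<le> B" "0 \<le> p"
  shows "f \<in> Lp_space S p"
proof -
  have S: "S \<in> lmeasurable"
    using assms lmeasurable_open by blast
  have meas: "f \<in> borel_measurable (lebesgue_on S)"
    using assms by (intro continuous_imp_measurable_on_sets_lebesgue) auto
  have "integrable (lebesgue_on S) (\<lambda>x. norm (f x) powr p)"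
  proof (rule finite_measure.integrable_const_bound[where B = "B powr p"])
    show "finite_measure (lebesgue_on S)"
      using S by (rule finite_measure_lebesgue_on)
    show "(\<lambda>x. norm (f x) powr p) \<in> borel_measurable (lebesgue_on S)"
      using meas by measurable
    show "AE x in lebesgue_on S. norm (norm (f x) powr p) \<le> B powr p"
      using assms by (intro AE_I2) (auto intro!: powr_mono2)
  qed
  with meas show ?thesis
    by (simp add: Lp_space_def)
qed

text \<open>Uses the classical Jacobian as weak gradient; for C^1 maps this supplies the number
  required by \<open>has_W1p_norm\<close>.\<close>

definition W1p_norm :: "(real^'n::finite) set \<Rightarrow> real \<Rightarrow> (real^'n \<Rightarrow> real^'m) \<Rightarrow> real" where
  "W1p_norm S p f = ((LINT x|lebesgue_on S. norm (f x) powr p) +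
     (LINT x|lebesgue_on S. norm (jacobian f (at x)) powr p)) powr (1 / p)"

lemma C1_on_compact_bound:
  fixes f :: "real^'n \<Rightarrow> real^'m"
  assumes "bounded S" "closure S \<subseteq> U" "C1_on U f"
  obtains B where "\<And>x. x \<in> S \<Longrightarrow> norm (f x) \<le> B" "\<And>x. x \<in> S \<Longrightarrow> norm (jacobian f (at x)) \<le> B"
proof -
  have cpt: "compact (closure S)" using assms by simp
  have "continuous_on (closure S) f" "continuous_on (closure S) (\<lambda>x. jacobian f (at x))"
    using assms(3) C1_on_continuous_on[OF assms(3)] continuous_on_subset[OF _ assms(2)]
    by (auto simp: C1_on_def)
  then have "compact ((\<lambda>x. (f x, jacobian f (at x))) ` closure S)"
    by (intro compact_continuous_image continuous_on_Pair cpt)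
  then have "bounded ((\<lambda>x. (f x, jacobian f (at x))) ` closure S)"
    by (rule compact_imp_bounded)
  then obtain B where B: "norm (f x, jacobian f (at x)) \<le> B" if "x \<in> closure S" for x
    unfolding bounded_iff by auto
  show ?thesis
  proof
    fix x assume "x \<in> S"
    then have "norm (f x, jacobian f (at x)) \<le> B"
      by (intro B subsetD[OF closure_subset])
    then show "norm (f x) \<le> B" "norm (jacobian f (at x)) \<le> B"
      using norm_fst_le[of "f x" "jacobian f (at x)"] norm_snd_le[of "jacobian f (at x)" "f x"]
      by linarith+
  qed
qed

text \<open>A C^1 map on an open set may blow up at the boundary; differentiability on a
  neighbourhood of the compact closure supplies the bounds.\<close>

lemma C1_on_Lp_space:
  fixes f :: "real^'n \<Rightarrow> real^'m"
  assumes "open S" "bounded S" "closure S \<subseteq> U" "C1_on U f" "0 \<le> p"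
  shows "f \<in> Lp_space S p" "(\<lambda>x. jacobian f (at x)) \<in> Lp_space S p"
proof -
  have C: "C1_on S f"
    using assms closure_subset C1_on_subset by (metis order_trans)
  obtain B where "\<And>x. x \<in> S \<Longrightarrow> norm (f x) \<le> B" "\<And>x. x \<in> S \<Longrightarrow> norm (jacobian f (at x)) \<le> B"
    using C1_on_compact_bound[OF assms(2-4)] by metis
  then show "f \<in> Lp_space S p" "(\<lambda>x. jacobian f (at x)) \<in> Lp_space S p"
    using C C1_on_continuous_on[OF C] assms by (auto intro!: bounded_continuous_in_Lp_space simp: C1_on_def)
qed

lemma C1_on_has_W1p_norm:
  fixes f :: "real^'n \<Rightarrow> real^'m"
  assumes "open S" "bounded S" "closure S \<subseteq> U" "C1_on U f" "0 \<le> p"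
  shows "has_W1p_norm S p f (W1p_norm S p f)"
proof -
  have "C1_on S f"
    using assms closure_subset C1_on_subset by (metis order_trans)
  then show ?thesis
    unfolding has_W1p_norm_def W1p_norm_def
    using C1_on_Lp_space[OF assms] C1_on_has_weak_gradient[OF assms(1)] by blast
qed

text \<open>Each of the two integrals is at most the measure of \<open>S\<close> times
  \<open>\<epsilon> powr p\<close>; the outer root leaves a constant times \<epsilon>.\<close>

lemma W1p_norm_le:
  fixes f :: "real^'n \<Rightarrow> real^'m"
  assumes "open S" "bounded S" "closure S \<subseteq> U" "C1_on U f" "1 \<le> p"
    and bd: "\<And>x. x \<in> S \<Longrightarrow> norm (f x) \<le> \<epsilon>" "\<And>x. x \<in> S \<Longrightarrow> norm (jacobian f (at x)) \<le> \<epsilon>"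
    and \<epsilon>: "0 \<le> \<epsilon>"
  shows "W1p_norm S p f \<le> (2 * measure lebesgue S) powr (1 / p) * \<epsilon>"
proof -
  have S: "S \<in> lmeasurable"
    using assms lmeasurable_open by blast
  interpret finite_measure "lebesgue_on S"
    using S by (rule finite_measure_lebesgue_on)
  have le: "(LINT x|lebesgue_on S. norm (g x) powr p) \<le> measure lebesgue S * \<epsilon> powr p"
    if "g \<in> Lp_space S p" "\<And>x. x \<in> S \<Longrightarrow> norm (g x) \<le> \<epsilon>" for g :: "real^'n \<Rightarrow> 'b::euclidean_space"
  proof -
    have "(LINT x|lebesgue_on S. norm (g x) powr p) \<le> (LINT x|lebesgue_on S. \<epsilon> powr p)"
      using that assms(5) by (intro integral_mono) (auto simp: Lp_space_def intro!: powr_mono2)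
    also have "\<dots> = measure lebesgue S * \<epsilon> powr p"
      using S by (simp add: measure_restrict_space fmeasurableD)
    finally show ?thesis .
  qed
  have "0 \<le> p" using assms by simp
  note Lp = C1_on_Lp_space[OF assms(1-4) this]
  have "W1p_norm S p f \<le> (2 * measure lebesgue S * \<epsilon> powr p) powr (1 / p)"
    unfolding W1p_norm_def using le[OF Lp(1) bd(1)] le[OF Lp(2) bd(2)] assms(5)
    by (intro powr_mono2 add_nonneg_nonneg integral_nonneg_AE) auto
  also have "\<dots> = (2 * measure lebesgue S) powr (1 / p) * \<epsilon>"
    using \<epsilon> assms(5) by (simp add: powr_mult powr_powr)
  finally show ?thesis .
qed

lemma Linf_norm_le:
  fixes f :: "real^'n \<Rightarrow> 'b::euclidean_space"
  assumes "open S" "continuous_on S f" "\<And>x. x \<in> S \<Longrightarrow> norm (f x) \<le> B"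
  shows "Linf_norm S f \<le> ennreal B"
  unfolding Linf_norm_def
proof (rule esssup_I)
  have "f \<in> borel_measurable (lebesgue_on S)"
    using assms by (intro continuous_imp_measurable_on_sets_lebesgue) auto
  then show "(\<lambda>x. ennreal (norm (f x))) \<in> borel_measurable (lebesgue_on S)"
    by measurable
  show "AE x in lebesgue_on S. ennreal (norm (f x)) \<le> ennreal B"
    using assms by (intro AE_I2 ennreal_leI) auto
qed

subsection \<open>Approximation by flow increments\<close>

lemma continuous_on_matrix_blinfun:
  fixes f :: "'a::t2_space \<Rightarrow> (real^'n) \<Rightarrow>\<^sub>L (real^'m)"
  assumes "continuous_on S f"
  shows "continuous_on S (\<lambda>x. matrix (blinfun_apply (f x)))"
  unfolding matrix_def by (intro continuous_intros assms)

text \<open>A crude bound summing all entries, each at most the operator norm. In dimension three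
  the factor is 9.\<close>

lemma norm_matrix_blinfun_le:
  fixes f :: "(real^'n) \<Rightarrow>\<^sub>L (real^'m)"
  shows "norm (matrix (blinfun_apply f)) \<le> real CARD('m) * (real CARD('n) * norm f)"
proof -
  have entry: "\<bar>matrix (blinfun_apply f) $ i $ j\<bar> \<le> norm f" for i j
    using order_trans[OF component_le_norm_cart[of "f (axis j 1)" i] norm_blinfun[of f "axis j 1"]]
    by (simp add: matrix_def norm_axis_1)
  have row: "norm (matrix (blinfun_apply f) $ i) \<le> real CARD('n) * norm f" for i
    using norm_le_l1_cart[of "matrix (blinfun_apply f) $ i"]
      sum_bounded_above[of UNIV "\<lambda>j. \<bar>matrix (blinfun_apply f) $ i $ j\<bar>", OF entry] by simp
  have "norm (matrix (blinfun_apply f)) \<le> (\<Sum>i\<in>UNIV. norm (matrix (blinfun_apply f) $ i))"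
    unfolding norm_vec_def by (rule L2_set_le_sum) simp
  also have "\<dots> \<le> real CARD('m) * (real CARD('n) * norm f)"
    using sum_bounded_above[of UNIV "\<lambda>i. norm (matrix (blinfun_apply f) $ i)", OF row] by simp
  finally show ?thesis .
qed

lemma jacobian_eqI: "(f has_derivative D) (at x) \<Longrightarrow> jacobian f (at x) = matrix D"
  by (simp add: jacobian_def frechet_derivative_at[symmetric])

lemma C1_onI_blinfun:
  fixes f :: "real^'n \<Rightarrow> real^'m"
  assumes "\<And>x. x \<in> S \<Longrightarrow> (f has_derivative blinfun_apply (f' x)) (at x)" "continuous_on S f'"
  shows "C1_on S f"
proof -
  have "jacobian f (at x) = matrix (blinfun_apply (f' x))" if "x \<in> S" for x
    by (rule jacobian_eqI[OF assms(1)[OF that]])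
  then have "continuous_on S (\<lambda>x. jacobian f (at x))"
    using continuous_on_matrix_blinfun[OF assms(2)] by (simp cong: continuous_on_cong)
  then show ?thesis
    using assms(1) by (auto simp: C1_on_def differentiable_def)
qed

lemma compact_support_bounded:
  fixes f :: "'a::heine_borel \<Rightarrow> 'b::real_normed_vector"
  assumes "continuous_on UNIV f" "compact K" "\<And>x. x \<notin> K \<Longrightarrow> f x = 0"
  obtains B where "0 < B" "\<And>x. norm (f x) \<le> B"
proof -
  have "bounded (f ` K)"
    using assms by (intro compact_imp_bounded compact_continuous_image) (auto intro: continuous_on_subset)
  then obtain B where B: "0 < B" "\<And>x. x \<in> K \<Longrightarrow> norm (f x) \<le> B"
    by (auto simp: bounded_pos)
  have "norm (f x) \<le> B" for x
    using B assms(3)[of x] by (cases "x \<in> K") auto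
  with B(1) show ?thesis by (rule that)
qed

text \<open>Inside a ball one unit larger than the support, compactness suffices. If one of two
  points less than 1 apart lies outside that ball, both miss \<open>K\<close>, and both values are
  0.\<close>

lemma compact_support_uniformly_continuous:
  fixes f :: "'a::euclidean_space \<Rightarrow> 'b::real_normed_vector"
  assumes cont: "continuous_on UNIV f" and "compact K" and zero: "\<And>x. x \<notin> K \<Longrightarrow> f x = 0"
  shows "uniformly_continuous_on UNIV f"
proof -
  obtain R where R: "\<And>x. x \<in> K \<Longrightarrow> norm x \<le> R"
    using compact_imp_bounded[OF assms(2)] by (auto simp: bounded_iff)
  have uc: "uniformly_continuous_on (cball 0 (R + 1)) f"
    by (intro compact_uniformly_continuous continuous_on_subset[OF cont]) auto
  show ?thesis
    unfolding uniformly_continuous_on_def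
  proof (intro allI impI)
    fix e :: real assume "0 < e"
    then obtain d where d: "0 < d" "\<And>x y. \<lbrakk>x \<in> cball 0 (R + 1); y \<in> cball 0 (R + 1); dist y x < d\<rbrakk> \<Longrightarrow> dist (f y) (f x) < e"
      by (rule uniformly_continuous_onE[OF uc]) blast
    have "dist (f y) (f x) < e" if "dist y x < min d 1" for x y
    proof (cases "norm x \<le> R + 1 \<and> norm y \<le> R + 1")
      case True
      then show ?thesis using d that by simp
    next
      case False
      moreover have "\<bar>norm y - norm x\<bar> < 1"
        using that norm_triangle_ineq3[of y x] by (simp add: dist_norm)
      ultimately have "x \<notin> K" "y \<notin> K"
        using R[of x] R[of y] by auto
      then show ?thesis using zero \<open>0 < e\<close> by simp
    qed
    then show "\<exists>d>0. \<forall>x\<in>UNIV. \<forall>x'\<in>UNIV. dist x' x < d \<longrightarrow> dist (f x') (f x) < e"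
      using d(1) by (intro exI[of _ "min d 1"]) auto
  qed
qed

section \<open>Globalizing the field and taking flow increments\<close>

text \<open>The flow construction needs a field on the whole space with bounded, uniformly
  continuous derivative. The cutoff times \<open>v\<close>, extended by zero, is such a field and
  equals \<open>v\<close> on a neighbourhood of \<open>K\<close>.\<close>

lemma C1_compact_support_extension:
  fixes v :: "real^'n \<Rightarrow> real^'m"
  assumes U: "open U" and K: "compact K" "K \<subseteq> U" and v: "C1_on U v"
  obtains w :: "real^'n \<Rightarrow> real^'m" and w' :: "real^'n \<Rightarrow> (real^'n) \<Rightarrow>\<^sub>L (real^'m)" and V B
  where "open V" "K \<subseteq> V" "V \<subseteq> U" "\<And>x. x \<in> V \<Longrightarrow> w x = v x"
    "\<And>x. (w has_derivative blinfun_apply (w' x)) (at x)" "uniformly_continuous_on UNIV w'"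
    "0 < B" "\<And>x. norm (w x) \<le> B" "\<And>x. norm (w' x) \<le> B"
proof -
  obtain \<eta> :: "real^'n \<Rightarrow> real" and d V L where
    \<eta>: "\<And>x. (\<eta> has_derivative (\<bullet>) (d x)) (at x)" "continuous_on UNIV d"
    and V: "open V" "K \<subseteq> V" "V \<subseteq> L" and L: "compact L" "L \<subseteq> U"
    and one: "\<And>x. x \<in> V \<Longrightarrow> \<eta> x = 1" and zero: "\<And>x. x \<notin> L \<Longrightarrow> \<eta> x = 0"
    using C1_cutoff[OF K(1) U K(2)] by metis
  have clL: "closed L" using L(1) by (rule compact_imp_closed)
  have d_zero: "d x = 0" if "x \<notin> L" for x
    using fun_cong[OF has_derivative_zero_outside[OF \<eta>(1) clL that zero], of "d x"] by simp
  define J where "J x = Blinfun ((*v) (jacobian v (at x)))" for x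
  have J: "blinfun_apply (J x) = (*v) (jacobian v (at x))" for x
    unfolding J_def by (rule bounded_linear_Blinfun_apply) (rule matrix_vector_mul_bounded_linear)
  have "continuous_on U (\<lambda>x. jacobian v (at x))"
    using v by (simp add: C1_on_def)
  then have J_cont: "continuous_on U J"
    by (intro continuous_on_blinfun_componentwise)
      (unfold J matrix_vector_mult_def, intro continuous_intros)
  have \<eta>_cont: "continuous_on S \<eta>" for S
    by (rule has_derivative_continuous_on[OF has_derivative_at_withinI[OF \<eta>(1)]])
  note v_cont = C1_on_continuous_on[OF v]
  define w where "w x = (if x \<in> U then \<eta> x *\<^sub>R v x else 0)" for x
  define w' where "w' x = (if x \<in> U
      then \<eta> x *\<^sub>R J x + (blinfun_scaleR_left (v x) o\<^sub>L blinfun_inner_left (d x)) else 0)" for x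
  have w_zero: "w x = 0" "w' x = 0" if "x \<notin> L" for x
  proof -
    have "blinfun_inner_left (0 :: real^'n) = 0"
      by (auto intro!: blinfun_eqI)
    then show "w x = 0" "w' x = 0"
      using that zero d_zero by (auto simp: w_def w'_def)
  qed
  have der: "(w has_derivative blinfun_apply (w' x)) (at x)" for x
  proof (cases "x \<in> U")
    case True
    have "((\<lambda>x. \<eta> x *\<^sub>R v x) has_derivative blinfun_apply (w' x)) (at x)"
      using True by (auto intro!: derivative_eq_intros \<eta>(1) C1_on_has_derivative[OF v]
          simp: w'_def J blinfun.bilinear_simps inner_commute)
    then show ?thesis
      by (rule has_derivative_transform_within_open[OF _ U True]) (simp add: w_def)
  next
    case False
    then have "x \<notin> L" using L by blast
    then have "(w has_derivative (\<lambda>_. 0)) (at x)"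
      using clL w_zero
      by (intro has_derivative_transform_within_open[OF has_derivative_const[of 0], of "- L"]) auto
    moreover have "blinfun_apply (w' x) = (\<lambda>_. 0)"
      using w_zero(2)[OF \<open>x \<notin> L\<close>] by (simp add: fun_eq_iff)
    ultimately show ?thesis by simp
  qed
  have w_cont: "continuous_on UNIV w"
    by (rule has_derivative_continuous_on[OF has_derivative_at_withinI[OF der]])
  have "continuous_on U (\<lambda>x. \<eta> x *\<^sub>R J x + (blinfun_scaleR_left (v x) o\<^sub>L blinfun_inner_left (d x)))"
    by (intro continuous_intros \<eta>_cont J_cont v_cont continuous_on_subset[OF \<eta>(2)]
        bounded_linear.continuous_on[OF bounded_linear_blinfun_scaleR_left]
        bounded_linear.continuous_on[OF bounded_linear_blinfun_inner_left]) auto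
  then have w'_cont: "continuous_on UNIV w'"
    unfolding w'_def
  proof (rule continuous_on_zero_extension[OF U clL L(2)])
    fix x assume "x \<in> U - L"
    then show "\<eta> x *\<^sub>R J x + (blinfun_scaleR_left (v x) o\<^sub>L blinfun_inner_left (d x)) = 0"
      using w_zero(2)[of x] by (simp add: w'_def)
  qed
  obtain B1 where "0 < B1" "\<And>x. norm (w x) \<le> B1"
    using compact_support_bounded[OF w_cont L(1) w_zero(1)] by metis
  moreover obtain B2 where "0 < B2" "\<And>x. norm (w' x) \<le> B2"
    using compact_support_bounded[OF w'_cont L(1) w_zero(2)] by metis
  ultimately have "0 < max B1 B2" "\<And>x. norm (w x) \<le> max B1 B2" "\<And>x. norm (w' x) \<le> max B1 B2"
    by (auto simp: le_max_iff_disj)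
  moreover have "w x = v x" if "x \<in> V" for x
    using that one V L by (auto simp: w_def)
  ultimately show ?thesis
    using V L der compact_support_uniformly_continuous[OF w'_cont L(1) w_zero(2)]
    by (intro that[of V w w' "max B1 B2"]) auto
qed

text \<open>Apply the time-one theory to \<open>h *\<^sub>R w\<close>, where \<kappa> and the bound
  on the field are both \<open>h * B\<close>, and divide the increment by \<open>h\<close>. The
  quadratic errors \<open>(h * B)\<^sup>2\<close> become linear in \<open>h\<close>. Determinant 1
  requires zero divergence only within \<open>h * B\<close> of \<open>x\<close>, the range of the
  trajectory.\<close>

lemma flow_increment:
  fixes w :: "real^3 \<Rightarrow> real^3"
  assumes der: "\<And>x. (w has_derivative blinfun_apply (w' x)) (at x)"
    and uc: "uniformly_continuous_on UNIV w'"
    and B: "\<And>x. norm (w x) \<le> B" "\<And>x. norm (w' x) \<le> B"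
    and h: "0 < h" "h * B \<le> 1/2"
  obtains f f' where "\<And>x. (f has_derivative blinfun_apply (f' x)) (at x)" "continuous_on UNIV f'"
    "\<And>x. w x = 0 \<Longrightarrow> f x = 0"
    "\<And>x. norm (f x - w x) \<le> h * B\<^sup>2"
    "\<And>x \<epsilon>. (\<And>y. norm (y - x) \<le> h * B \<Longrightarrow> norm (w' y - w' x) \<le> \<epsilon>) \<Longrightarrow>
      norm (f' x - w' x) \<le> 2 * \<epsilon> + 2 * h * B\<^sup>2"
    "\<And>x. (\<And>y. norm (y - x) \<le> h * B \<Longrightarrow> (\<Sum>i\<in>UNIV. w' y (axis i 1) $ i) = 0) \<Longrightarrow>
      det (mat 1 + h *\<^sub>R matrix (blinfun_apply (f' x))) = 1"
proof -
  define F where "F x = h *\<^sub>R w x" for x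
  define F' where "F' x = h *\<^sub>R w' x" for x
  have sf: "small_field F F' (h * B)"
  proof
    show "(F has_derivative blinfun_apply (F' x)) (at x)" for x
      unfolding F_def F'_def by (auto intro!: derivative_eq_intros der simp: blinfun.bilinear_simps)
    show "uniformly_continuous_on UNIV F'"
      unfolding F'_def by (intro uniformly_continuous_on_cmul uc)
    show "norm (F' x) \<le> h * B" for x
      using B(2) h by (simp add: F'_def)
  qed (use h in simp)
  interpret small_field F F' "h * B" by (fact sf)
  have FB: "norm (F x) \<le> h * B" for x
    using B(1) h by (simp add: F_def)
  define f where "f x = (u x 1 - x) /\<^sub>R h" for x
  define f' where "f' x = (M x 1 - id_blinfun) /\<^sub>R h" for x
  have scale: "norm (z /\<^sub>R h) \<le> c / h" if "norm z \<le> c" for z :: "'z::real_normed_vector" and c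
  proof -
    have "norm (z /\<^sub>R h) = norm z / h"
      using h(1) by (simp add: divide_inverse)
    with divide_right_mono[OF that, of h] h(1) show ?thesis by simp
  qed
  show ?thesis
  proof (rule that[of f f'])
    show "(f has_derivative blinfun_apply (f' x)) (at x)" for x
      unfolding f_def f'_def
      by (auto intro!: derivative_eq_intros flow_has_derivative simp: blinfun.bilinear_simps)
    show "continuous_on UNIV f'"
      unfolding f'_def by (intro continuous_intros M_continuous_space)
    show "f x = 0" if "w x = 0" for x
      using u_rest[of x 1] that by (simp add: f_def F_def)
    show "norm (f x - w x) \<le> h * B\<^sup>2" for x
    proof -
      have "f x - w x = (u x 1 - x - F x) /\<^sub>R h"
        using h by (simp add: f_def F_def scaleR_diff_right)
      then have "norm (f x - w x) \<le> (h * B * (h * B)) / h"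
        using scale[OF u_first_order[OF FB]] by simp
      then show ?thesis
        using h(1) by (simp add: power2_eq_square ac_simps)
    qed
    show "norm (f' x - w' x) \<le> 2 * \<epsilon> + 2 * h * B\<^sup>2"
      if \<epsilon>: "\<And>y. norm (y - x) \<le> h * B \<Longrightarrow> norm (w' y - w' x) \<le> \<epsilon>" for x \<epsilon>
    proof -
      have "norm (F' y - F' x) \<le> h * \<epsilon>" if "norm (y - x) \<le> h * B" for y
        using \<epsilon>[OF that] h by (simp add: F'_def flip: scaleR_diff_right)
      then have "norm (M x 1 - id_blinfun - F' x) \<le> 2 * (h * \<epsilon>) + 2 * (h * B)\<^sup>2"
        by (rule M_first_order[OF FB])
      then have "norm ((M x 1 - id_blinfun - F' x) /\<^sub>R h) \<le> (2 * (h * \<epsilon>) + 2 * (h * B)\<^sup>2) / h"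
        by (rule scale)
      moreover have "f' x - w' x = (M x 1 - id_blinfun - F' x) /\<^sub>R h"
        using h by (simp add: f'_def F'_def scaleR_diff_right)
      moreover have "(2 * (h * \<epsilon>) + 2 * (h * B)\<^sup>2) / h = 2 * \<epsilon> + 2 * h * B\<^sup>2"
        using h(1) by (simp add: power2_eq_square field_simps)
      ultimately show ?thesis by simp
    qed
    show "det (mat 1 + h *\<^sub>R matrix (blinfun_apply (f' x))) = 1"
      if div: "\<And>y. norm (y - x) \<le> h * B \<Longrightarrow> (\<Sum>i\<in>UNIV. w' y (axis i 1) $ i) = 0" for x
    proof -
      have "mat 1 + h *\<^sub>R matrix (blinfun_apply (f' x)) = matrix (blinfun_apply (M x 1))"
        using h(1) by (simp add: vec_eq_iff matrix_def f'_def mat_def axis_def blinfun.bilinear_simps mult.assoc[symmetric])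
      moreover have "(\<Sum>i\<in>UNIV. F' (u x t) (axis i 1) $ i) = 0" if "t \<in> {0..1}" for t
        using div[OF u_near[OF FB that, of x]]
        by (simp add: F'_def blinfun.bilinear_simps flip: sum_distrib_left)
      ultimately show ?thesis
        using flow_det[OF sf] by simp
    qed
  qed
qed

section \<open>Sobolev convergence from uniform convergence\<close>

lemma C1_on_diff:
  fixes f g :: "real^'n \<Rightarrow> real^'m"
  assumes "C1_on S f" "C1_on S g"
  shows "C1_on S (\<lambda>x. f x - g x)"
    and "x \<in> S \<Longrightarrow> jacobian (\<lambda>x. f x - g x) (at x) = jacobian f (at x) - jacobian g (at x)"
proof -
  have der: "((\<lambda>x. f x - g x) has_derivative (*v) (jacobian f (at x) - jacobian g (at x))) (at x)"
    if "x \<in> S" for x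
    by (rule has_derivative_eq_rhs[OF has_derivative_diff[OF C1_on_has_derivative[OF assms(1) that]
            C1_on_has_derivative[OF assms(2) that]]])
      (simp add: fun_eq_iff matrix_vector_mult_diff_rdistrib)
  have jac: "jacobian (\<lambda>x. f x - g x) (at x) = jacobian f (at x) - jacobian g (at x)"
    if "x \<in> S" for x
    using jacobian_eqI[OF der[OF that]] by simp
  then show "x \<in> S \<Longrightarrow> jacobian (\<lambda>x. f x - g x) (at x) = jacobian f (at x) - jacobian g (at x)" .
  have "continuous_on S (\<lambda>x. jacobian f (at x) - jacobian g (at x))"
    using assms by (intro continuous_intros) (auto simp: C1_on_def)
  then show "C1_on S (\<lambda>x. f x - g x)"
    using der by (auto simp: C1_on_def differentiable_def jac cong: continuous_on_cong)
qed

lemma converges_in_W1p_if_uniform_C1: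
  fixes f :: "nat \<Rightarrow> real^'n \<Rightarrow> real^'m"
  assumes S: "open S" "bounded S" "closure S \<subseteq> U"
    and f: "\<And>j. C1_on U (f j)" and g: "C1_on U g"
    and conv: "\<And>e. 0 < e \<Longrightarrow> \<forall>\<^sub>F j in sequentially. \<forall>x\<in>S.
      norm (f j x - g x) \<le> e \<and> norm (jacobian (f j) (at x) - jacobian g (at x)) \<le> e"
    and p: "1 \<le> p"
  shows "converges_in_W1p S p f g"
proof -
  define N where "N j = W1p_norm S p (\<lambda>x. f j x - g x)" for j
  define C where "C = (2 * measure lebesgue S) powr (1 / p)"
  have C: "0 \<le> C" by (simp add: C_def)
  have p0: "0 \<le> p" using p by simp
  have SU: "S \<subseteq> U" using S(3) closure_subset by blast
  have "N \<longlonglongrightarrow> 0"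
  proof (rule tendstoI)
    fix e :: real assume e: "0 < e"
    \<comment> \<open>The denominator \<open>C + 1\<close> also covers \<open>C = 0\<close>.\<close>
    define \<epsilon> where "\<epsilon> = e / (C + 1)"
    have \<epsilon>: "0 < \<epsilon>" "C * \<epsilon> < e"
      using e C by (auto simp: \<epsilon>_def field_simps)
    show "\<forall>\<^sub>F j in sequentially. dist (N j) 0 < e"
      using conv[OF \<epsilon>(1)]
    proof eventually_elim
      case (elim j)
      have "N j \<le> C * \<epsilon>"
        unfolding N_def C_def
      proof (rule W1p_norm_le[OF S C1_on_diff(1)[OF f g] p])
        fix x assume x: "x \<in> S"
        then have "x \<in> U" using SU by blast
        from C1_on_diff(2)[OF f g this] show "norm (f j x - g x) \<le> \<epsilon>"
            "norm (jacobian (\<lambda>x. f j x - g x) (at x)) \<le> \<epsilon>"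
          using elim x by auto
      qed (use \<epsilon> in simp)
      moreover have "0 \<le> N j"
        by (simp add: N_def W1p_norm_def)
      ultimately show ?case
        using \<epsilon> by simp
    qed
  qed
  moreover have "has_W1p_norm S p (\<lambda>x. f j x - g x) (N j)" for j
    unfolding N_def by (rule C1_on_has_W1p_norm[OF S C1_on_diff(1)[OF f g] p0])
  ultimately show ?thesis
    unfolding converges_in_W1p_def W1p_def
    using C1_on_has_W1p_norm[OF S f p0] C1_on_has_W1p_norm[OF S g p0] by blast
qed

section \<open>Choice of the sequence and verification of its properties\<close>

theorem lemma4p1:
  fixes \<Omega> \<Omega>' \<Gamma> :: "(real^3) set"
    and v :: "real^3 \<Rightarrow> real^3"
    and h :: "nat \<Rightarrow> real"
  assumes "open \<Omega>" and "bounded \<Omega>"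
    and "\<Gamma> \<subseteq> frontier \<Omega>"
    and "open \<Omega>'" and "closure \<Omega> \<subseteq> \<Omega>'"
    and "C1_on \<Omega>' v"
    and "\<forall>x\<in>\<Omega>'. divergence v x = 0"
    and "\<forall>x\<in>\<Gamma>. v x = 0"
    and "\<forall>j. h j > 0"
    and "h \<longlonglongrightarrow> 0"
  shows "\<exists>vs :: nat \<Rightarrow> real^3 \<Rightarrow> real^3.
      (\<forall>j. C1_on \<Omega>' (vs j)) \<and>
      (\<forall>j. \<forall>x\<in>\<Omega>. det (mat 1 + h j *\<^sub>R jacobian (vs j) (at x)) = 1) \<and>
      (\<forall>j. \<forall>x\<in>\<Gamma>. vs j x = 0) \<and>
      (\<forall>p\<ge>1. converges_in_W1p \<Omega> p vs v) \<and>
      (\<lambda>j. Linf_norm \<Omega> (\<lambda>x. h j *\<^sub>R jacobian (vs j) (at x))) \<longlonglongrightarrow> 0"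
proof -
  define K where "K = closure \<Omega>"
  have K: "compact K" "K \<subseteq> \<Omega>'" and \<Omega>_K: "\<Omega> \<subseteq> K" and \<Gamma>_K: "\<Gamma> \<subseteq> K"
    using assms(2,3,5) closure_subset[of \<Omega>] by (auto simp: K_def frontier_def)
  obtain w :: "real^3 \<Rightarrow> real^3" and w' V B where V: "open V" "K \<subseteq> V" "V \<subseteq> \<Omega>'"
    and w_eq: "\<And>x. x \<in> V \<Longrightarrow> w x = v x"
    and w: "\<And>x. (w has_derivative blinfun_apply (w' x)) (at x)" "uniformly_continuous_on UNIV w'"
    and B: "0 < B" "\<And>x. norm (w x) \<le> B" "\<And>x. norm (w' x) \<le> B"
    by (rule C1_compact_support_extension[OF assms(4) K assms(6)]) (rule that)
  have jac_v: "jacobian v (at x) = matrix (blinfun_apply (w' x))" if "x \<in> V" for x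
    by (rule jacobian_eqI[OF has_derivative_transform_within_open[OF w(1) V(1) that w_eq]])
  have div: "(\<Sum>i\<in>UNIV. w' y (axis i 1) $ i) = 0" if "y \<in> V" for y
    using assms(7) V(3) that jac_v[OF that] by (force simp: divergence_def matrix_def)
  \<comment> \<open>A uniform neighbourhood of \<open>K\<close> inside \<open>V\<close>: points
    moving less than \<delta> from \<Omega> stay where \<open>w\<close> is divergence free.\<close>
  obtain \<delta> where \<delta>: "0 < \<delta>" "(\<Union>x\<in>K. ball x \<delta>) \<subseteq> V"
    using compact_subset_open_imp_ball_epsilon_subset[OF K(1) V(1,2)] by metis
  define small where "small j \<longleftrightarrow> h j * B \<le> 1/2 \<and> h j * B < \<delta>" for j
  \<comment> \<open>Exact properties are asserted for every \<open>j\<close>, estimates only for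
    small \<open>h j\<close>; a single choice then yields the whole sequence with its
    derivatives.\<close>
  have "\<exists>f f'. (\<forall>x. (f has_derivative blinfun_apply (f' x)) (at x)) \<and> continuous_on UNIV f' \<and>
      (\<forall>x. w x = 0 \<longrightarrow> f x = 0) \<and>
      (\<forall>x\<in>\<Omega>. det (mat 1 + h j *\<^sub>R matrix (blinfun_apply (f' x))) = 1) \<and>
      (small j \<longrightarrow> (\<forall>x. norm (f x - w x) \<le> h j * B\<^sup>2) \<and>
        (\<forall>x \<epsilon>. (\<forall>y. norm (y - x) \<le> h j * B \<longrightarrow> norm (w' y - w' x) \<le> \<epsilon>) \<longrightarrow>
          norm (f' x - w' x) \<le> 2 * \<epsilon> + 2 * h j * B\<^sup>2))" (is "\<exists>f f'. ?P f f'") for j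
  proof (cases "small j")
    case True
    then have hB: "h j * B \<le> 1/2" and near: "h j * B < \<delta>" by (auto simp: small_def)
    obtain f f' where f: "\<And>x. (f has_derivative blinfun_apply (f' x)) (at x)" "continuous_on UNIV f'"
      "\<And>x. w x = 0 \<Longrightarrow> f x = 0"
      "\<And>x. norm (f x - w x) \<le> h j * B\<^sup>2"
      "\<And>x \<epsilon>. (\<And>y. norm (y - x) \<le> h j * B \<Longrightarrow> norm (w' y - w' x) \<le> \<epsilon>) \<Longrightarrow>
        norm (f' x - w' x) \<le> 2 * \<epsilon> + 2 * h j * B\<^sup>2"
      "\<And>x. (\<And>y. norm (y - x) \<le> h j * B \<Longrightarrow> (\<Sum>i\<in>UNIV. w' y (axis i 1) $ i) = 0) \<Longrightarrow>
        det (mat 1 + h j *\<^sub>R matrix (blinfun_apply (f' x))) = 1"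
      by (rule flow_increment[OF w B(2,3) assms(9)[rule_format] hB]) blast
    have "det (mat 1 + h j *\<^sub>R matrix (blinfun_apply (f' x))) = 1" if "x \<in> \<Omega>" for x
    proof (rule f(6), rule div)
      fix y assume "norm (y - x) \<le> h j * B"
      then have "y \<in> ball x \<delta>"
        using near by (simp add: dist_norm norm_minus_commute)
      then show "y \<in> V"
        using \<delta>(2) that \<Omega>_K by blast
    qed
    with f(1-5) have "?P f f'" by simp
    then show ?thesis by blast
  next
    case False
    \<comment> \<open>For large \<open>h j\<close> the zero field has determinant 1, and the
      estimates are vacuous.\<close>
    then have "?P (\<lambda>_. 0) (\<lambda>_. 0)"
      by (simp add: zero_blinfun.rep_eq matrix_def flip: zero_vec_def)
    then show ?thesis
      by (intro exI[of _ "\<lambda>_. 0"])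
  qed
  then obtain f f' where f: "\<And>j x. (f j has_derivative blinfun_apply (f' j x)) (at x)"
      "\<And>j. continuous_on UNIV (f' j)" "\<And>j x. w x = 0 \<Longrightarrow> f j x = 0"
      "\<And>j x. x \<in> \<Omega> \<Longrightarrow> det (mat 1 + h j *\<^sub>R matrix (blinfun_apply (f' j x))) = 1"
      "\<And>j x. small j \<Longrightarrow> norm (f j x - w x) \<le> h j * B\<^sup>2"
      "\<And>j x \<epsilon>. small j \<Longrightarrow> (\<And>y. norm (y - x) \<le> h j * B \<Longrightarrow> norm (w' y - w' x) \<le> \<epsilon>) \<Longrightarrow>
          norm (f' j x - w' x) \<le> 2 * \<epsilon> + 2 * h j * B\<^sup>2"
    by metis
  have jac: "jacobian (f j) (at x) = matrix (blinfun_apply (f' j x))" for j x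
    by (rule jacobian_eqI[OF f(1)])
  have C1: "C1_on S (f j)" for S j
    by (rule C1_onI_blinfun[OF f(1) continuous_on_subset[OF f(2)]]) simp
  have h_small: "\<forall>\<^sub>F j in sequentially. h j * c < e" if "0 < e" for c e
    by (rule order_tendstoD(2)[OF tendsto_mult_left_zero[OF assms(10)] that])
  have conv: "\<forall>\<^sub>F j in sequentially. \<forall>x\<in>\<Omega>.
      norm (f j x - v x) \<le> e \<and> norm (jacobian (f j) (at x) - jacobian v (at x)) \<le> e" if e: "0 < e" for e
  proof -
    \<comment> \<open>With \<open>e / 36\<close> for both the modulus and
      \<open>h j * B\<^sup>2\<close>, the operator error is at most 2e/36 + 2e/36 = e/9; the matrix
      norm costs the factor 9.\<close>
    obtain d where d: "0 < d" "\<And>x y. dist y x < d \<Longrightarrow> dist (w' y) (w' x) < e / 36"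
      by (rule uniformly_continuous_onE[OF w(2), of "e / 36"]) (use e in auto)
    have "\<forall>\<^sub>F j in sequentially. h j * B < 1/2" "\<forall>\<^sub>F j in sequentially. h j * B < \<delta>"
        "\<forall>\<^sub>F j in sequentially. h j * B < d" "\<forall>\<^sub>F j in sequentially. h j * B\<^sup>2 < e / 36"
      by (rule h_small, use e d(1) \<delta>(1) in simp)+
    then show ?thesis
    proof eventually_elim
      case (elim j)
      then have sm: "small j" by (simp add: small_def)
      show ?case
      proof (intro ballI conjI)
        fix x assume "x \<in> \<Omega>"
        then have x: "x \<in> V" using \<Omega>_K V(2) by blast
        show "norm (f j x - v x) \<le> e"
          using f(5)[OF sm, of x] w_eq[OF x] elim(4) e by simp
        have "norm (w' y - w' x) \<le> e / 36" if "norm (y - x) \<le> h j * B" for y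
          using d(2)[of y x] that elim(3) by (simp add: dist_norm)
        from f(6)[OF sm this] have "norm (f' j x - w' x) \<le> e / 9"
          using elim(4) by simp
        then have "norm (matrix (blinfun_apply (f' j x - w' x))) \<le> e"
          using norm_matrix_blinfun_le[of "f' j x - w' x"] by simp
        moreover have "matrix (blinfun_apply (f' j x - w' x)) = jacobian (f j) (at x) - jacobian v (at x)"
          by (simp add: jac jac_v[OF x] matrix_def vec_eq_iff blinfun.diff_left)
        ultimately show "norm (jacobian (f j) (at x) - jacobian v (at x)) \<le> e"
          by simp
      qed
    qed
  qed
  \<comment> \<open>Convergence with tolerance 1 gives a Jacobian bound \<open>1 + 9 * B\<close> for
    late \<open>j\<close>, and the factor \<open>h j\<close> drives the norm to 0.\<close>
  have Linf_le: "\<forall>\<^sub>F j in sequentially. Linf_norm \<Omega> (\<lambda>x. h j *\<^sub>R jacobian (f j) (at x)) \<le> ennreal (h j * (1 + 9 * B))"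
    using conv[OF zero_less_one]
  proof eventually_elim
    case (elim j)
    show ?case
    proof (rule Linf_norm_le[OF assms(1)])
      show "continuous_on \<Omega> (\<lambda>x. h j *\<^sub>R jacobian (f j) (at x))"
        using C1[of \<Omega> j] by (auto simp: C1_on_def intro!: continuous_intros)
      fix x assume x: "x \<in> \<Omega>"
      then have "x \<in> V" using \<Omega>_K V(2) by blast
      then have "norm (jacobian v (at x)) \<le> 9 * B"
        using norm_matrix_blinfun_le[of "w' x"] B(3)[of x] by (simp add: jac_v)
      moreover have "norm (jacobian (f j) (at x) - jacobian v (at x)) \<le> 1"
        using elim x by blast
      ultimately have "norm (jacobian (f j) (at x)) \<le> 1 + 9 * B"
        using norm_triangle_sub[of "jacobian (f j) (at x)" "jacobian v (at x)"] by linarith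
      then show "norm (h j *\<^sub>R jacobian (f j) (at x)) \<le> h j * (1 + 9 * B)"
        using assms(9) by (simp add: mult_left_mono abs_of_pos)
    qed
  qed
  have bound_0: "(\<lambda>j. ennreal (h j * (1 + 9 * B))) \<longlonglongrightarrow> 0"
    using tendsto_ennrealI[OF tendsto_mult_left_zero[OF assms(10), of "1 + 9 * B"]] by simp
  have Linf: "(\<lambda>j. Linf_norm \<Omega> (\<lambda>x. h j *\<^sub>R jacobian (f j) (at x))) \<longlonglongrightarrow> 0"
    by (rule tendsto_sandwich[OF _ Linf_le tendsto_const bound_0]) simp
  show ?thesis
  proof (intro exI[of _ f] conjI allI ballI impI)
    show "det (mat 1 + h j *\<^sub>R jacobian (f j) (at x)) = 1" if "x \<in> \<Omega>" for j x
      using f(4)[OF that] by (simp add: jac)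
    show "f j x = 0" if "x \<in> \<Gamma>" for j x
    proof (rule f(3))
      have "x \<in> V" using that \<Gamma>_K V(2) by blast
      then show "w x = 0" using w_eq assms(8) that by simp
    qed
    show "converges_in_W1p \<Omega> p f v" if "1 \<le> p" for p
      by (rule converges_in_W1p_if_uniform_C1[OF assms(1,2,5) C1 assms(6) conv that])
  qed (fact C1 Linf)+
qed

end
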